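(* Let $G$ be a finite simple graph and let $\|\cdot\|_{\mathcal{P}}$ be a polyhedral norm on $\mathbb{R}^2$. The following statements are equivalent: (i) $G$ is minimally rigid in $(\mathbb{R}^2,\|\cdot\|_{\mathcal{P}})$; (ii) $G$ is $(2,2)$-tight.
   Context: Graphs have non-empty vertex sets. Let $\mathcal{P}\subset\mathbb{R}^2$ be a convex symmetric ($\mathcal P=-\mathcal P$) $2$-dimensional polytope. The associated polyhedral norm is $\|x\|_{\mathcal{P}}=\inf\{\lambda\ge 0: x\in\lambda\mathcal{P}\}$. For a facet $F$ of $\mathcal P$, $\mathrm{cone}(F)$ is the set of all finite non-negative linear combinations of points of $F$. A placement of a simple graph $G=(V(G),E(G))$ is a map $p:V(G)\to\mathbb{R}^2$ with $p_v\neq p_w$ whenever $vw\in E(G)$; the pair $(G,p)$ is a bar-joint framework. The placement is well-positioned if for each edge $vw$ the vector $p_v-p_w$ is contained in $\mathrm{cone}(F)$ for exactly one facet $F$ of $\mathcal{P}$. An infinitesimal flex of $(G,p)$ is a map $u:V(G)\to\mathbb{R}^2$ such that for each edge $vw$, $\|(p_v+tu_v)-(p_w+tu_w)\|_{\mathcal{P}}-\|p_v-p_w\|_{\mathcal{P}}=o(t)$ as $t\to 0$; it is trivial if it is constant. $(G,p)$ is infinitesimally rigid if every infinitesimal flex is trivial, and minimally infinitesimally rigid if moreover every framework obtained by removing a single edge from $G$ (keeping all vertices) is not infinitesimally rigid. $G$ is minimally rigid in $(\mathbb{R}^2,\|\cdot\|_{\mathcal{P}})$ if there exists a well-positioned placement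 $p$ of $G$ such that $(G,p)$ is minimally infinitesimally rigid. $G$ is $(2,2)$-tight if $|E(G)|=2|V(G)|-2$ and $|E(H)|\le 2|V(H)|-2$ for all subgraphs $H$ of $G$. *)

theory Defs
  imports "HOL-Analysis.Analysis" "HOL-Library.Landau_Symbols"
begin

section \<open>Polyhedral norms on the plane\<close>

text \<open>Symmetry and full dimension put the origin in the interior of \<open>P\<close>, so \<open>poly_norm P\<close>
  below is a norm with unit ball \<open>P\<close>. Polytopes of the library are convex by definition.\<close>

definition symmetric_polytope2 :: "(real^2) set \<Rightarrow> bool" where
  "symmetric_polytope2 P \<longleftrightarrow> polytope P \<and> P = uminus ` P \<and> aff_dim P = 2"

definition poly_norm :: "(real^2) set \<Rightarrow> real^2 \<Rightarrow> real" where
  "poly_norm P x = Inf {l. 0 \<le> l \<and> x \<in> (\<lambda>y. l *\<^sub>R y) ` P}"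

definition nonneg_combinations :: "(real^2) set \<Rightarrow> (real^2) set" where
  "nonneg_combinations F =
     {(\<Sum>x\<in>S. c x *\<^sub>R x) | S c. finite S \<and> S \<subseteq> F \<and> (\<forall>x\<in>S. 0 \<le> c x)}"

section \<open>Graphs\<close>

definition simple_graph :: "'a set \<Rightarrow> 'a set set \<Rightarrow> bool" where
  "simple_graph V E \<longleftrightarrow> V \<noteq> {} \<and> (\<forall>e\<in>E. e \<subseteq> V \<and> card e = 2)"

definition subgraph_of :: "'a set \<Rightarrow> 'a set set \<Rightarrow> 'a set \<Rightarrow> 'a set set \<Rightarrow> bool" where
  "subgraph_of W D V E \<longleftrightarrow> simple_graph W D \<and> W \<subseteq> V \<and> D \<subseteq> E"

definition tight22 :: "'a set \<Rightarrow> 'a set set \<Rightarrow> bool" where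
  "tight22 V E \<longleftrightarrow>
     int (card E) = 2 * int (card V) - 2 \<and>
     (\<forall>W D. subgraph_of W D V E \<longrightarrow> int (card D) \<le> 2 * int (card W) - 2)"

section \<open>Frameworks\<close>

text \<open>Placements and flexes are total functions on the vertex type; only their values on the
  vertex set matter in the definitions below.\<close>

definition placement :: "'a set set \<Rightarrow> ('a \<Rightarrow> real^2) \<Rightarrow> bool" where
  "placement E p \<longleftrightarrow> (\<forall>v w. {v, w} \<in> E \<longrightarrow> p v \<noteq> p w)"

definition well_positioned :: "(real^2) set \<Rightarrow> 'a set set \<Rightarrow> ('a \<Rightarrow> real^2) \<Rightarrow> bool" where
  "well_positioned P E p \<longleftrightarrow>
     (\<forall>v w. {v, w} \<in> E \<longrightarrow> (\<exists>!F. F facet_of P \<and> p v - p w \<in> nonneg_combinations F))"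

definition inf_flex ::
    "(real^2) set \<Rightarrow> 'a set set \<Rightarrow> ('a \<Rightarrow> real^2) \<Rightarrow> ('a \<Rightarrow> real^2) \<Rightarrow> bool" where
  "inf_flex P E p u \<longleftrightarrow>
     (\<forall>v w. {v, w} \<in> E \<longrightarrow>
        (\<lambda>t::real. poly_norm P ((p v + t *\<^sub>R u v) - (p w + t *\<^sub>R u w)) - poly_norm P (p v - p w))
          \<in> o[at 0](\<lambda>t. t))"

definition trivial_flex :: "'a set \<Rightarrow> ('a \<Rightarrow> real^2) \<Rightarrow> bool" where
  "trivial_flex V u \<longleftrightarrow> (\<exists>c. \<forall>v\<in>V. u v = c)"

definition inf_rigid ::
    "(real^2) set \<Rightarrow> 'a set \<Rightarrow> 'a set set \<Rightarrow> ('a \<Rightarrow> real^2) \<Rightarrow> bool" where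
  "inf_rigid P V E p \<longleftrightarrow> (\<forall>u. inf_flex P E p u \<longrightarrow> trivial_flex V u)"

definition min_inf_rigid ::
    "(real^2) set \<Rightarrow> 'a set \<Rightarrow> 'a set set \<Rightarrow> ('a \<Rightarrow> real^2) \<Rightarrow> bool" where
  "min_inf_rigid P V E p \<longleftrightarrow>
     inf_rigid P V E p \<and> (\<forall>e\<in>E. \<not> inf_rigid P V (E - {e}) p)"

definition minimally_rigid :: "(real^2) set \<Rightarrow> 'a set \<Rightarrow> 'a set set \<Rightarrow> bool" where
  "minimally_rigid P V E \<longleftrightarrow>
     (\<exists>p. placement E p \<and> well_positioned P E p \<and> min_inf_rigid P V E p)"

end

theory Submission
  imports Defs
begin

text \<open>For a well-positioned edge the flex condition is one linear equation, given by the normal of the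
  facet whose cone contains the edge vector. Minimal rigidity makes these equations independent, so
  counting equations against unknowns gives the \<open>(2,2)\<close>-counts.

  For the converse, choose an extreme point \<open>x0\<close> of \<open>P\<close> and a transversal direction \<open>y0\<close>, and put
  the vertex \<open>v\<close> at \<open>x v *\<^sub>R x0 + s *\<^sub>R (y v *\<^sub>R y0)\<close> with \<open>s\<close> tiny. Then all edge vectors are close to
  the line through \<open>x0\<close>, and the sign of \<open>(x v - x w) * (y v - y w)\<close> decides in which of two fixed
  facet pairs at \<open>\<plusminus>x0\<close> the edge \<open>vw\<close> lies. The two normals are independent, so the placement is
  rigid as soon as the edges of each sign connect all vertices. It remains to find, for each tight
  graph, real functions \<open>x\<close> and \<open>y\<close> with this property; the norm plays no role here.\<close>

section \<open>Linear equations and tight graphs\<close>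

text \<open>A splitting of the edges into two spanning trees would not be enough: the trees must be
  cut out by the signs of coordinate differences. For this reason the induction produces the
  coordinates themselves, and each inductive step has to be realised by placing one new point or by
  shrinking one drawing into a point of another. Injectivity of \<open>x\<close> and
  \<open>y\<close> gives every edge a strict sign, so small perturbations keep all signs.

  Two sign classes suffice for every norm because only the facets through \<open>x0\<close> compete
  for an edge vector close to the ray of \<open>x0\<close>, and the tilt along \<open>y0\<close>
  picks the one whose normal has the largest or the smallest product with \<open>y0\<close>. Any
  polytope then behaves like a parallelogram.\<close>

lemma homogeneous_system_nontrivial_solution:
  fixes A :: "'j \<Rightarrow> 'i \<Rightarrow> 'k::field"
  assumes "finite J" "finite I" "card J < card I"
  shows "\<exists>x. (\<exists>i\<in>I. x i \<noteq> 0) \<and> (\<forall>j\<in>J. (\<Sum>i\<in>I. A j i * x i) = 0)"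
  using assms
proof (induction J arbitrary: A I rule: finite_induct)
  case empty
  then have "I \<noteq> {}" by auto
  then show ?case by (intro exI[of _ "\<lambda>_. 1"]) auto
next
  case (insert j J)
  show ?case
  proof (cases "\<forall>i\<in>I. A j i = 0")
    case True
    have "card J < card I" using insert by simp
    from insert.IH[OF insert.prems(1) this, of A] True show ?thesis by auto
  next
    case False
    then obtain k where k: "k \<in> I" "A j k \<noteq> 0" by auto
    \<comment> \<open>Gaussian elimination: equation \<open>j\<close> is solved for the unknown
      \<open>k\<close> and substituted into the other equations. Below, \<open>t\<close> is the
      value of that unknown which equation \<open>j\<close> forces.\<close>
    define B where "B = (\<lambda>l i. A l i - A l k * A j i / A j k)"
    have "card J < card (I - {k})" using insert k by simp
    with insert.IH[of "I - {k}" B] insert.prems obtain x i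
      where x: "i \<in> I - {k}" "x i \<noteq> 0" "\<And>l. l \<in> J \<Longrightarrow> (\<Sum>i\<in>I - {k}. B l i * x i) = 0"
      by auto
    define t where "t = - (\<Sum>i\<in>I - {k}. A j i * x i) / A j k"
    have sum_I: "(\<Sum>i\<in>I. A l i * (x(k := t)) i) = A l k * t + (\<Sum>i\<in>I - {k}. A l i * x i)" for l
      using k insert.prems by (subst sum.remove[of _ k]) auto
    have "(\<Sum>i\<in>I. A l i * (x(k := t)) i) = 0" if "l \<in> insert j J" for l
    proof (cases "l = j")
      case True
      show ?thesis unfolding True sum_I using k(2) by (simp add: t_def)
    next
      case False
      then have "0 = (\<Sum>i\<in>I - {k}. B l i * x i)" using x that by auto
      also have "\<dots> = (\<Sum>i\<in>I - {k}. A l i * x i) + A l k * t"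
        unfolding B_def t_def
        by (simp add: left_diff_distrib sum_subtractf sum_distrib_left sum_divide_distrib mult.assoc)
      finally show ?thesis unfolding sum_I by (simp add: add.commute)
    qed
    moreover have "\<exists>i\<in>I. (x(k := t)) i \<noteq> 0" using x by (auto intro!: bexI[of _ i])
    ultimately show ?thesis by blast
  qed
qed

text \<open>The counts stay in \<open>nat\<close> by moving the 2 to the other side. Among the
  subgraphs with vertex set \<open>X\<close> the induced one has the most edges, so bounding these
  is enough.\<close>

definition tight_graph :: "'a set \<Rightarrow> 'a set set \<Rightarrow> bool" where
  "tight_graph V E \<longleftrightarrow> finite V \<and> simple_graph V E \<and> card E + 2 = 2 * card V \<and>
     (\<forall>X\<subseteq>V. X \<noteq> {} \<longrightarrow> card {e\<in>E. e \<subseteq> X} + 2 \<le> 2 * card X)"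

lemma finite_edges: "finite V \<Longrightarrow> simple_graph V E \<Longrightarrow> finite E"
  unfolding simple_graph_def by (rule finite_subset[of _ "Pow V"]) auto

lemma tight22_imp_tight_graph:
  assumes "finite V" "simple_graph V E" "tight22 V E"
  shows "tight_graph V E"
proof -
  have "card {e\<in>E. e \<subseteq> X} + 2 \<le> 2 * card X" if "X \<subseteq> V" "X \<noteq> {}" for X
  proof -
    have "subgraph_of X {e\<in>E. e \<subseteq> X} V E"
      using that assms(2) unfolding subgraph_of_def simple_graph_def by auto
    then have "int (card {e\<in>E. e \<subseteq> X}) \<le> 2 * int (card X) - 2"
      using assms(3) unfolding tight22_def by blast
    then show ?thesis by linarith
  qed
  moreover have "card E + 2 = 2 * card V"
    using assms(3) unfolding tight22_def by linarith
  ultimately show ?thesis using assms unfolding tight_graph_def by auto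
qed

section \<open>Drawings with connected sign classes\<close>

text \<open>Connectedness of the graph formed by the edges of sign \<open>s\<close>, expressed
  without paths. The functions \<open>f\<close> to which it is finally applied are the components of
  a flex along a facet normal.\<close>

definition sign_connected ::
    "real \<Rightarrow> 'a set \<Rightarrow> 'a set set \<Rightarrow> ('a \<Rightarrow> real) \<Rightarrow> ('a \<Rightarrow> real) \<Rightarrow> bool" where
  "sign_connected s V E x y \<longleftrightarrow>
     (\<forall>f::'a \<Rightarrow> real. (\<forall>v w. {v, w} \<in> E \<and> 0 < s * ((x v - x w) * (y v - y w)) \<longrightarrow> f v = f w) \<longrightarrow>
        (\<forall>v\<in>V. \<forall>w\<in>V. f v = f w))"

definition biconnected_drawing ::
    "'a set \<Rightarrow> 'a set set \<Rightarrow> ('a \<Rightarrow> real) \<Rightarrow> ('a \<Rightarrow> real) \<Rightarrow> bool" where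
  "biconnected_drawing V E x y \<longleftrightarrow>
     inj_on x V \<and> inj_on y V \<and> (\<forall>s\<in>{1, -1}. sign_connected s V E x y)"

text \<open>The common core of the two vertex extensions. An edge of each sign at \<open>v\<close>
  attaches it to both sign classes, and a deleted edge \<open>cd\<close> is replaced by the path
  through \<open>v\<close>, whose two edges must have the same sign as \<open>cd\<close>.\<close>

lemma biconnected_drawing_insert:
  assumes draw: "biconnected_drawing V E x y" and E: "\<And>e. e \<in> E \<Longrightarrow> e \<subseteq> V"
    and v: "v \<notin> V" and new: "z \<notin> x ` V" "t \<notin> y ` V"
    and joined: "\<And>s. s \<in> {1, -1} \<Longrightarrow> \<exists>c\<in>V. {v, c} \<in> E' \<and> 0 < s * ((z - x c) * (t - y c))"
    and removed: "\<And>s c d. s \<in> {1, -1} \<Longrightarrow> {c, d} \<in> E - E' \<Longrightarrow> 0 < s * ((x c - x d) * (y c - y d)) \<Longrightarrow>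
      {v, c} \<in> E' \<and> 0 < s * ((z - x c) * (t - y c)) \<and> {v, d} \<in> E' \<and> 0 < s * ((z - x d) * (t - y d))"
  shows "biconnected_drawing (insert v V) E' (x(v := z)) (y(v := t))"
  unfolding biconnected_drawing_def
proof (intro conjI ballI)
  show "inj_on (x(v := z)) (insert v V)" "inj_on (y(v := t)) (insert v V)"
    using draw new v unfolding biconnected_drawing_def inj_on_def by (auto split: if_splits)
  fix s :: real assume s: "s \<in> {1, -1}"
  show "sign_connected s (insert v V) E' (x(v := z)) (y(v := t))"
    unfolding sign_connected_def
  proof (intro allI impI)
    fix f :: "'a \<Rightarrow> real"
    assume f: "\<forall>c d. {c, d} \<in> E' \<and> 0 < s * (((x(v := z)) c - (x(v := z)) d) * ((y(v := t)) c - (y(v := t)) d))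
                \<longrightarrow> f c = f d"
    have star: "f v = f c" if "c \<in> V" "{v, c} \<in> E'" "0 < s * ((z - x c) * (t - y c))" for c
      using f[rule_format, of v c] that v by (cases "c = v") auto
    have "f c = f d" if "{c, d} \<in> E" "0 < s * ((x c - x d) * (y c - y d))" for c d
    proof -
      have cd: "c \<in> V" "d \<in> V" using E[OF that(1)] by auto
      then have ne: "c \<noteq> v" "d \<noteq> v" using v by auto
      show ?thesis
      proof (cases "{c, d} \<in> E'")
        case True
        then show ?thesis using f[rule_format, of c d] that ne by simp
      next
        case False
        then show ?thesis using removed[OF s, of c d] star[of c] star[of d] that cd by auto
      qed
    qed
    moreover have "sign_connected s V E x y"
      using draw s unfolding biconnected_drawing_def by blast
    ultimately have V: "\<forall>c\<in>V. \<forall>d\<in>V. f c = f d"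
      unfolding sign_connected_def by meson
    moreover obtain c where "c \<in> V" "f v = f c"
      using joined[OF s] star by blast
    ultimately show "\<forall>c\<in>insert v V. \<forall>d\<in>insert v V. f c = f d" by (metis insert_iff)
  qed
qed

lemma biconnected_drawing_add_degree_two:
  assumes draw: "biconnected_drawing V E x y" and E: "\<And>e. e \<in> E \<Longrightarrow> e \<subseteq> V"
    and V: "finite V" "v \<notin> V" "a \<in> V" "b \<in> V" "a \<noteq> b"
    and E': "E \<subseteq> E'" "{v, a} \<in> E'" "{v, b} \<in> E'"
  shows "\<exists>x y. biconnected_drawing (insert v V) E' x y"
proof -
  have *: "\<exists>x y. biconnected_drawing (insert v V) E' x y"
    if ab: "a \<in> V" "b \<in> V" "x a < x b" "{v, a} \<in> E'" "{v, b} \<in> E'" for a b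
  proof -
    \<comment> \<open>The new point is placed above all others and horizontally between
      \<open>a\<close> and \<open>b\<close>. It lies to the upper right of \<open>a\<close> and to
      the upper left of \<open>b\<close>, which gives one edge of each sign.\<close>
    have "infinite ({x a <..< x b} - x ` V)" using ab V by (simp add: Diff_infinite_finite)
    then obtain z where z: "z \<in> {x a <..< x b} - x ` V" by (metis finite.emptyI ex_in_conv)
    define t where "t = Max (y ` V) + 1"
    have t: "y c < t" if "c \<in> V" for c
    proof -
      have "y c \<le> Max (y ` V)" using V that by (intro Max_ge) auto
      then show ?thesis unfolding t_def by simp
    qed
    have a: "0 < (z - x a) * (t - y a)" using z t ab by simp
    have b: "0 < - ((z - x b) * (t - y b))" using z t[of b] ab by (simp add: mult_neg_pos)
    have "biconnected_drawing (insert v V) E' (x(v := z)) (y(v := t))"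
    proof (rule biconnected_drawing_insert[OF draw E])
      show "t \<notin> y ` V" using t by fastforce
      show "\<exists>c\<in>V. {v, c} \<in> E' \<and> 0 < s * ((z - x c) * (t - y c))" if "s \<in> {1, -1}" for s
        using that a b ab by auto
    qed (use V z E' in auto)
    then show ?thesis by blast
  qed
  have "x a \<noteq> x b" using draw V unfolding biconnected_drawing_def inj_on_def by auto
  then show ?thesis using *[of a b] *[of b a] V E' by fastforce
qed

text \<open>A line through the first two points has slope of sign \<open>s\<close>, and next to the abscissa of the
  third point it passes into a quadrant of sign \<open>-s\<close> of that point, unless it contains the third
  point; in that case a small move off the line is needed.\<close>

lemma edge_split_position:
  fixes x y :: "'b \<Rightarrow> real"
  assumes s: "s \<in> {1, -1::real}"
    and ab: "0 < s * ((x a - x b) * (y a - y b))"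
    and c: "x c \<noteq> x a" "x c \<noteq> x b" "y c \<noteq> y a" "y c \<noteq> y b"
    and fin: "finite X" "finite Y"
  shows "\<exists>z t. z \<notin> X \<and> t \<notin> Y \<and> 0 < s * ((z - x a) * (t - y a)) \<and> 0 < s * ((z - x b) * (t - y b))
    \<and> 0 < - s * ((z - x c) * (t - y c))"
proof -
  have neq: "\<forall>\<^sub>F h in at_right 0. u + k * h \<noteq> w" if "k \<noteq> 0" for u k w :: real
  proof -
    have "\<forall>\<^sub>F h in at_right 0. h \<noteq> (w - u) / k"
      using eventually_neq_at_within[of "(w - u) / k" "0::real"] by simp
    then show ?thesis by eventually_elim (use that in \<open>auto simp: field_simps\<close>)
  qed
  have avoid: "\<forall>\<^sub>F h in at_right 0. u + k * h \<notin> S" if "k \<noteq> 0" "finite S" for u k :: real and S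
  proof -
    have "\<forall>\<^sub>F h in at_right 0. \<forall>w\<in>S. u + k * h \<noteq> w"
      using that neq by (intro eventually_ball_finite) auto
    then show ?thesis by eventually_elim auto
  qed
  define m where "m = (y b - y a) / (x b - x a)"
  have xne: "x a \<noteq> x b" using ab by auto
  have "s * ((x a - x b) * (y a - y b)) = s * m * (x b - x a)^2"
    using xne unfolding m_def by (simp add: field_simps power2_eq_square)
  then have "0 < s * m * (x b - x a)^2" using ab by linarith
  then have sm: "0 < s * m" by (rule zero_less_mult_pos2) (use xne in simp)
  have yb: "y b = y a + m * (x b - x a)" using xne unfolding m_def by simp
  define l where "l = y a + m * (x c - x a)"
  have tend: "((\<lambda>h::real. u + k * h) \<longlongrightarrow> u) (at_right 0)" for u k :: real
    by (rule tendsto_eq_intros | simp)+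
  \<comment> \<open>The point sought is \<open>(x c + k * h, u + k' * h)\<close> for small positive
    \<open>h\<close>. Nonzero speeds in both coordinates make it miss the finite sets
    \<open>X\<close> and \<open>Y\<close> eventually.\<close>
  have "\<exists>k k' u. k \<noteq> 0 \<and> k' \<noteq> 0 \<and> (\<forall>\<^sub>F h in at_right 0.
      0 < s * ((x c + k * h - x a) * (u + k' * h - y a)) \<and>
      0 < s * ((x c + k * h - x b) * (u + k' * h - y b)) \<and>
      0 < - s * ((x c + k * h - x c) * (u + k' * h - y c)))"
  proof (cases "l = y c")
    case True
    \<comment> \<open>The motion starts at \<open>c\<close> itself. The direction
      \<open>(1, - s)\<close> enters a quadrant of sign \<open>- s\<close> of \<open>c\<close>,
      while the products with \<open>a\<close> and \<open>b\<close> are positive at \<open>c\<close>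
      and stay so by continuity.\<close>
    have t: "((\<lambda>h. s * ((x c + 1 * h - w) * (y c + (- s) * h - w'))) \<longlongrightarrow> s * ((x c - w) * (y c - w')))
      (at_right 0)" for w w'
      by (intro tendsto_intros tend)
    have "y c - y a = m * (x c - x a)" using True unfolding l_def by simp
    then have "s * ((x c - x a) * (y c - y a)) = s * m * (x c - x a)^2"
      by (simp add: power2_eq_square)
    moreover have "0 < s * m * (x c - x a)^2" using sm c by simp
    ultimately have a: "0 < s * ((x c - x a) * (y c - y a))" by linarith
    have "y c - y b = m * (x c - x b)" using True unfolding l_def yb by (simp add: algebra_simps)
    then have "s * ((x c - x b) * (y c - y b)) = s * m * (x c - x b)^2"
      by (simp add: power2_eq_square)
    moreover have "0 < s * m * (x c - x b)^2" using sm c by simp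
    ultimately have b: "0 < s * ((x c - x b) * (y c - y b))" by linarith
    have "\<forall>\<^sub>F h in at_right 0. 0 < - s * ((x c + 1 * h - x c) * (y c + (- s) * h - y c))"
      using s by (auto simp: eventually_at_filter)
    with order_tendstoD(1)[OF t a] order_tendstoD(1)[OF t b]
    have "\<forall>\<^sub>F h in at_right 0.
      0 < s * ((x c + 1 * h - x a) * (y c + (- s) * h - y a)) \<and>
      0 < s * ((x c + 1 * h - x b) * (y c + (- s) * h - y b)) \<and>
      0 < - s * ((x c + 1 * h - x c) * (y c + (- s) * h - y c))"
      by eventually_elim auto
    moreover have "- s \<noteq> 0" using s by auto
    ultimately show ?thesis
      by (intro exI[of _ 1] exI[of _ "- s"] exI[of _ "y c"] conjI) simp_all
  next
    case False
    \<comment> \<open>The point stays on the line through \<open>a\<close> and \<open>b\<close>, so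
      its products with them are \<open>s * m\<close> times a square. The sign of \<open>k\<close>
      selects the side of \<open>x c\<close> on which the quadrant of \<open>c\<close> facing the
      line at height \<open>l\<close> has sign \<open>- s\<close>.\<close>
    define k where "k = s * sgn (y c - l)"
    have k: "k \<noteq> 0" "k * m \<noteq> 0" using s False sm unfolding k_def by (auto simp: sgn_if)
    have "\<forall>\<^sub>F h in at_right 0. 0 < (y c - l) * (y c - (l + (k * m) * h))"
    proof (rule order_tendstoD(1))
      show "((\<lambda>h. (y c - l) * (y c - (l + k * m * h))) \<longlongrightarrow> (y c - l) * (y c - l)) (at_right 0)"
        by (intro tendsto_intros tend)
    qed (use False in \<open>simp add: zero_less_mult_iff, linarith\<close>)
    moreover have "\<forall>\<^sub>F h in at_right 0. 0 < (h::real)" by (simp add: eventually_at_filter)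
    ultimately have "\<forall>\<^sub>F h in at_right 0.
      0 < s * ((x c + k * h - x a) * (l + (k * m) * h - y a)) \<and>
      0 < s * ((x c + k * h - x b) * (l + (k * m) * h - y b)) \<and>
      0 < - s * ((x c + k * h - x c) * (l + (k * m) * h - y c))"
      using neq[OF k(1), of "x c" "x a"] neq[OF k(1), of "x c" "x b"]
    proof eventually_elim
      case (elim h)
      have "s * ((x c + k * h - x a) * (l + (k * m) * h - y a)) = s * m * (x c + k * h - x a)^2"
        unfolding l_def by (simp add: power2_eq_square algebra_simps)
      moreover have "s * ((x c + k * h - x b) * (l + (k * m) * h - y b)) = s * m * (x c + k * h - x b)^2"
        unfolding l_def yb by (simp add: power2_eq_square algebra_simps)
      moreover have "- s * ((x c + k * h - x c) * (l + (k * m) * h - y c))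
          = h * (sgn (y c - l) * (y c - (l + k * m * h)))"
        using s unfolding k_def by (auto simp: algebra_simps)
      moreover have "0 < sgn (y c - l) * (y c - (l + k * m * h))"
        using elim(1) by (auto simp: sgn_if zero_less_mult_iff)
      moreover have "0 < s * m * (x c + k * h - x a)^2" "0 < s * m * (x c + k * h - x b)^2"
        using sm elim(3,4) by simp_all
      ultimately show ?case using mult_pos_pos[OF elim(2)] by presburger
    qed
    then show ?thesis
      by (intro exI[of _ k] exI[of _ "k * m"] exI[of _ l] conjI k)
  qed
  then obtain k k' u where k: "k \<noteq> 0" "k' \<noteq> 0" and ev: "\<forall>\<^sub>F h in at_right 0.
      0 < s * ((x c + k * h - x a) * (u + k' * h - y a)) \<and>
      0 < s * ((x c + k * h - x b) * (u + k' * h - y b)) \<and>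
      0 < - s * ((x c + k * h - x c) * (u + k' * h - y c))" by blast
  have "\<forall>\<^sub>F h in at_right 0. x c + k * h \<notin> X \<and> u + k' * h \<notin> Y \<and>
      0 < s * ((x c + k * h - x a) * (u + k' * h - y a)) \<and>
      0 < s * ((x c + k * h - x b) * (u + k' * h - y b)) \<and>
      0 < - s * ((x c + k * h - x c) * (u + k' * h - y c))"
    using ev avoid[OF k(1) fin(1), of "x c"] avoid[OF k(2) fin(2), of u]
    by eventually_elim auto
  from eventually_happens'[OF trivial_limit_at_right_real this] show ?thesis by blast
qed

text \<open>Let \<open>s\<close> be the sign of \<open>ab\<close>. The new vertex takes over this
  edge by two edges of sign \<open>s\<close> to \<open>a\<close> and \<open>b\<close>, and the edge
  to \<open>c\<close> attaches it to the other class.\<close>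

lemma biconnected_drawing_edge_split:
  assumes draw: "biconnected_drawing V (insert {a, b} E) x y"
    and E: "\<And>e. e \<in> E \<Longrightarrow> e \<subseteq> V"
    and V: "finite V" "v \<notin> V" "a \<in> V" "b \<in> V" "c \<in> V" "a \<noteq> b" "a \<noteq> c" "b \<noteq> c"
    and E': "E \<subseteq> E'" "{v, a} \<in> E'" "{v, b} \<in> E'" "{v, c} \<in> E'"
  shows "\<exists>x y. biconnected_drawing (insert v V) E' x y"
proof -
  have inj: "x i \<noteq> x j" "y i \<noteq> y j" if "i \<in> V" "j \<in> V" "i \<noteq> j" for i j
    using draw that unfolding biconnected_drawing_def inj_on_def by auto
  define s where "s = sgn ((x a - x b) * (y a - y b))"
  have s: "s \<in> {1, -1}" "0 < s * ((x a - x b) * (y a - y b))"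
    unfolding s_def using inj[of a b] V by (auto simp: sgn_if not_less less_le)
  obtain z t where zt: "z \<notin> x ` V" "t \<notin> y ` V"
    "0 < s * ((z - x a) * (t - y a))" "0 < s * ((z - x b) * (t - y b))"
    "0 < - s * ((z - x c) * (t - y c))"
    using edge_split_position[OF s, of c "x ` V" "y ` V"] inj V by auto
  have "biconnected_drawing (insert v V) E' (x(v := z)) (y(v := t))"
  proof (rule biconnected_drawing_insert[OF draw])
    show "\<And>e. e \<in> insert {a, b} E \<Longrightarrow> e \<subseteq> V" using E V by auto
    show "\<exists>c\<in>V. {v, c} \<in> E' \<and> 0 < s' * ((z - x c) * (t - y c))" if "s' \<in> {1, -1}" for s'
    proof (cases "s' = s")
      case True
      then show ?thesis using zt V E' by auto
    next
      case False
      then have "s' = - s" using that s by auto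
      then show ?thesis using zt V E' by (intro bexI[of _ c]) auto
    qed
    show "{v, i} \<in> E' \<and> 0 < s' * ((z - x i) * (t - y i)) \<and> {v, j} \<in> E' \<and> 0 < s' * ((z - x j) * (t - y j))"
      if "s' \<in> {1, -1}" "{i, j} \<in> insert {a, b} E - E'" "0 < s' * ((x i - x j) * (y i - y j))" for s' i j
    proof -
      have ij: "i = a \<and> j = b \<or> i = b \<and> j = a" using that E' by (auto simp: doubleton_eq_iff)
      then have "(x i - x j) * (y i - y j) = (x a - x b) * (y a - y b)" by (auto simp: algebra_simps)
      then have "s' = s" using that s by auto
      then show ?thesis using ij zt E' by auto
    qed
  qed (use V zt in auto)
  then show ?thesis by blast
qed

lemma biconnected_drawing_K4:
  assumes d: "distinct [a, b, c, d]"
    and E: "{a, b} \<in> E" "{a, c} \<in> E" "{a, d} \<in> E" "{b, c} \<in> E" "{b, d} \<in> E" "{c, d} \<in> E"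
  shows "\<exists>x y. biconnected_drawing {a, b, c, d} E x y"
proof -
  \<comment> \<open>This is the permutation 2413. Its increasing pairs form the path b-a-d-c and its
    decreasing pairs the path a-c-b-d, so both classes span the four vertices.\<close>
  define x where "x = (\<lambda>v. if v = a then 1 else if v = b then 2 else if v = c then 3 else 4 :: real)"
  define y where "y = (\<lambda>v. if v = a then 2 else if v = b then 4 else if v = c then 1 else 3 :: real)"
  have xy: "x a = 1" "x b = 2" "x c = 3" "x d = 4" "y a = 2" "y b = 4" "y c = 1" "y d = 3"
    using d by (auto simp: x_def y_def)
  have "biconnected_drawing {a, b, c, d} E x y"
    unfolding biconnected_drawing_def
  proof (intro conjI ballI)
    show "inj_on x {a, b, c, d}" "inj_on y {a, b, c, d}" using xy by (auto simp: inj_on_def)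
    fix s :: real assume s: "s \<in> {1, -1}"
    show "sign_connected s {a, b, c, d} E x y"
      unfolding sign_connected_def
    proof (intro allI impI)
      fix f :: "'a \<Rightarrow> real"
      assume f: "\<forall>v w. {v, w} \<in> E \<and> 0 < s * ((x v - x w) * (y v - y w)) \<longrightarrow> f v = f w"
      note f' = f[rule_format, OF conjI]
      consider "s = 1" | "s = -1" using s by blast
      then show "\<forall>v\<in>{a, b, c, d}. \<forall>w\<in>{a, b, c, d}. f v = f w"
      proof cases
        case 1
        have "f a = f b" "f a = f d" "f c = f d"
          by (rule f'; use E 1 in \<open>simp add: xy\<close>)+
        then show ?thesis by simp
      next
        case 2
        have "f a = f c" "f b = f c" "f b = f d"
          by (rule f'; use E 2 in \<open>simp add: xy\<close>)+
        then show ?thesis by simp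
      qed
    qed
  qed
  then show ?thesis by blast
qed

text \<open>The drawing of \<open>W\<close>, scaled by a small \<open>h\<close>, is put in place of
  the vertex \<open>w\<close> of the contracted drawing. Inside \<open>W\<close> the products of
  differences are multiplied by \<open>h^2\<close> and keep their sign; the other edges keep theirs
  because the points converge to their contracted positions as \<open>h\<close> tends to 0.\<close>

lemma biconnected_drawing_blow_up:
  assumes V: "finite V" "W \<subseteq> V" "w \<in> W"
    and inner: "biconnected_drawing W {e\<in>E. e \<subseteq> W} x0 y0"
    and outer: "biconnected_drawing (insert w (V - W))
      ((`) (\<lambda>v. if v \<in> W then w else v) ` {e\<in>E. \<not> e \<subseteq> W}) x y"
    and E: "\<And>e. e \<in> E \<Longrightarrow> e \<subseteq> V \<and> card e = 2"
  shows "\<exists>x y. biconnected_drawing V E x y"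
proof -
  define r where "r = (\<lambda>v. if v \<in> W then w else v)"
  define blow :: "('a \<Rightarrow> real) \<Rightarrow> ('a \<Rightarrow> real) \<Rightarrow> real \<Rightarrow> 'a \<Rightarrow> real"
    where "blow = (\<lambda>x x0 h v. x (r v) + (if v \<in> W then h * x0 v else 0))"
  have tend: "((\<lambda>h. blow x x0 h v) \<longlongrightarrow> x (r v)) (at_right 0)" for x x0 v
    unfolding blow_def by (cases "v \<in> W") (auto intro!: tendsto_eq_intros)
  have r: "r v \<in> insert w (V - W)" if "v \<in> V" for v using that unfolding r_def by auto
  have inj: "\<forall>\<^sub>F h in at_right 0. \<forall>p\<in>V \<times> V. r (fst p) \<noteq> r (snd p) \<longrightarrow>
      blow x x0 h (fst p) \<noteq> blow x x0 h (snd p)" if "inj_on x (insert w (V - W))" for x x0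
  proof (rule eventually_ball_finite)
    show "\<forall>p\<in>V \<times> V. \<forall>\<^sub>F h in at_right 0. r (fst p) \<noteq> r (snd p) \<longrightarrow>
      blow x x0 h (fst p) \<noteq> blow x x0 h (snd p)"
    proof
      fix p assume p: "p \<in> V \<times> V"
      show "\<forall>\<^sub>F h in at_right 0. r (fst p) \<noteq> r (snd p) \<longrightarrow> blow x x0 h (fst p) \<noteq> blow x x0 h (snd p)"
      proof (cases "r (fst p) = r (snd p)")
        case False
        then have "x (r (fst p)) - x (r (snd p)) \<noteq> 0"
          using inj_onD[OF that] r p by (auto simp: mem_Times_iff)
        then have "\<forall>\<^sub>F h in at_right 0. blow x x0 h (fst p) - blow x x0 h (snd p) \<noteq> 0"
          by (intro tendsto_imp_eventually_ne[OF tendsto_diff[OF tend tend]])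
        then show ?thesis by eventually_elim auto
      qed simp
    qed
  qed (use V in auto)
  define prd :: "real \<Rightarrow> real \<Rightarrow> 'a \<times> 'a \<Rightarrow> real"
    where "prd = (\<lambda>h s p. s * ((blow x x0 h (fst p) - blow x x0 h (snd p)) * (blow y y0 h (fst p) - blow y y0 h (snd p))))"
  have sgn: "\<forall>\<^sub>F h in at_right 0. \<forall>p\<in>V \<times> V.
      0 < s * ((x (r (fst p)) - x (r (snd p))) * (y (r (fst p)) - y (r (snd p)))) \<longrightarrow> 0 < prd h s p" for s
  proof (rule eventually_ball_finite)
    show "\<forall>p\<in>V \<times> V. \<forall>\<^sub>F h in at_right 0.
      0 < s * ((x (r (fst p)) - x (r (snd p))) * (y (r (fst p)) - y (r (snd p)))) \<longrightarrow> 0 < prd h s p"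
    proof
      fix p
      have "((\<lambda>h. prd h s p) \<longlongrightarrow> s * ((x (r (fst p)) - x (r (snd p))) * (y (r (fst p)) - y (r (snd p))))) (at_right 0)"
        unfolding prd_def by (intro tendsto_intros tend)
      from order_tendstoD(1)[OF this]
      show "\<forall>\<^sub>F h in at_right 0. 0 < s * ((x (r (fst p)) - x (r (snd p))) * (y (r (fst p)) - y (r (snd p)))) \<longrightarrow> 0 < prd h s p"
        by (cases "0 < s * ((x (r (fst p)) - x (r (snd p))) * (y (r (fst p)) - y (r (snd p))))") auto
    qed
  qed (use V in auto)
  have injs: "inj_on x (insert w (V - W))" "inj_on y (insert w (V - W))" "inj_on x0 W" "inj_on y0 W"
    using inner outer unfolding biconnected_drawing_def by auto
  have pos: "\<forall>\<^sub>F h in at_right 0. 0 < (h::real)" by (simp add: eventually_at_filter)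
  have sgns: "\<forall>\<^sub>F h in at_right 0. \<forall>s\<in>{1, -1}. \<forall>p\<in>V \<times> V.
      0 < s * ((x (r (fst p)) - x (r (snd p))) * (y (r (fst p)) - y (r (snd p)))) \<longrightarrow> 0 < prd h s p"
    by (rule eventually_ball_finite[OF _ ballI[OF sgn]]) simp
  from eventually_happens'[OF trivial_limit_at_right_real
      eventually_conj[OF pos eventually_conj[OF eventually_conj[OF inj[OF injs(1), of x0] inj[OF injs(2), of y0]] sgns]]]
  obtain h where h: "0 < h"
    and hx: "\<forall>p\<in>V \<times> V. r (fst p) \<noteq> r (snd p) \<longrightarrow> blow x x0 h (fst p) \<noteq> blow x x0 h (snd p)"
    and hy: "\<forall>p\<in>V \<times> V. r (fst p) \<noteq> r (snd p) \<longrightarrow> blow y y0 h (fst p) \<noteq> blow y y0 h (snd p)"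
    and hs: "\<forall>s\<in>{1, -1}. \<forall>p\<in>V \<times> V.
      0 < s * ((x (r (fst p)) - x (r (snd p))) * (y (r (fst p)) - y (r (snd p)))) \<longrightarrow> 0 < prd h s p"
    by (elim exE conjE) (rule that)
  have inj_blow: "inj_on (blow x x0 h) V"
    if "\<forall>p\<in>V \<times> V. r (fst p) \<noteq> r (snd p) \<longrightarrow> blow x x0 h (fst p) \<noteq> blow x x0 h (snd p)"
      "inj_on x0 W" for x x0
  proof (rule inj_onI, rule ccontr)
    fix u v assume uv: "u \<in> V" "v \<in> V" "blow x x0 h u = blow x x0 h v" "u \<noteq> v"
    then have "r u = r v" using bspec[OF that(1), of "(u, v)"] by auto
    then have "u \<in> W" "v \<in> W" using uv V unfolding r_def by (auto split: if_splits)
    then show False using uv that(2) h unfolding blow_def r_def inj_on_def by auto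
  qed
  have "biconnected_drawing V E (blow x x0 h) (blow y y0 h)"
    unfolding biconnected_drawing_def
  proof (intro conjI ballI)
    show "inj_on (blow x x0 h) V" "inj_on (blow y y0 h) V"
      by (rule inj_blow[OF hx injs(3)], rule inj_blow[OF hy injs(4)])
    fix s :: real assume s: "s \<in> {1, -1}"
    show "sign_connected s V E (blow x x0 h) (blow y y0 h)"
      unfolding sign_connected_def
    proof (intro allI impI)
      fix f :: "'a \<Rightarrow> real"
      assume f: "\<forall>c d. {c, d} \<in> E \<and> 0 < s * ((blow x x0 h c - blow x x0 h d) * (blow y y0 h c - blow y y0 h d))
          \<longrightarrow> f c = f d"
      have "f c = f d" if "{c, d} \<in> {e\<in>E. e \<subseteq> W}" "0 < s * ((x0 c - x0 d) * (y0 c - y0 d))" for c d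
      proof -
        have "c \<in> W" "d \<in> W" using that by auto
        then have "s * ((blow x x0 h c - blow x x0 h d) * (blow y y0 h c - blow y y0 h d)) =
            h^2 * (s * ((x0 c - x0 d) * (y0 c - y0 d)))"
          unfolding blow_def r_def by (simp add: power2_eq_square algebra_simps)
        also have "\<dots> > 0" using that h by simp
        finally show ?thesis using f[rule_format, of c d] that by simp
      qed
      moreover have "sign_connected s W {e\<in>E. e \<subseteq> W} x0 y0"
        using inner s unfolding biconnected_drawing_def by blast
      ultimately have "\<forall>c\<in>W. \<forall>d\<in>W. f c = f d"
        unfolding sign_connected_def by meson
      then have W: "f c = f d" if "c \<in> W" "d \<in> W" for c d using that by blast
      \<comment> \<open>Being constant on \<open>W\<close>, the function \<open>f\<close> does not
        see the contraction \<open>r\<close>, so it can be tested on the contracted graph.\<close>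
      have fr: "f (r c) = f c" for c using W[of w c] V unfolding r_def by auto
      have "f c = f d" if cd: "{c, d} \<in> (`) r ` {e\<in>E. \<not> e \<subseteq> W}" "0 < s * ((x c - x d) * (y c - y d))" for c d
      proof -
        obtain e where e: "e \<in> E" "{c, d} = r ` e" using cd by auto
        then obtain c' d' where cd': "e = {c', d'}" using E[of e] by (auto simp: card_2_iff)
        have *: "f c = f d" if e': "{c', d'} \<in> E" "c = r c'" "d = r d'" for c' d'
        proof -
          have "(c', d') \<in> V \<times> V" using E e' by auto
          from hs[rule_format, OF s this] have "0 < prd h s (c', d')" using cd(2) e' by simp
          then have "f c' = f d'" using f[rule_format, of c' d'] e'(1) unfolding prd_def by simp
          then show ?thesis unfolding e' fr .
        qed
        have "c = r c' \<and> d = r d' \<or> c = r d' \<and> d = r c'"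
          using e(2) cd' by (auto simp: doubleton_eq_iff)
        moreover have "{c', d'} \<in> E" "{d', c'} \<in> E" using e cd' by (simp_all add: insert_commute)
        ultimately show ?thesis using * by blast
      qed
      moreover have "sign_connected s (insert w (V - W)) ((`) r ` {e\<in>E. \<not> e \<subseteq> W}) x y"
        using outer s unfolding biconnected_drawing_def r_def by blast
      ultimately have "\<forall>c\<in>insert w (V - W). \<forall>d\<in>insert w (V - W). f c = f d"
        unfolding sign_connected_def by meson
      then have "f (r c) = f (r d)" if "c \<in> V" "d \<in> V" for c d using r that by blast
      then show "\<forall>c\<in>V. \<forall>d\<in>V. f c = f d" unfolding fr by blast
    qed
  qed
  then show ?thesis by blast
qed

section \<open>Counting edges in tight graphs\<close>

lemma tight_graphD:
  assumes "tight_graph V E"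
  shows "finite V" "V \<noteq> {}" "finite E" "card E + 2 = 2 * card V"
    "\<And>e. e \<in> E \<Longrightarrow> e \<subseteq> V" "\<And>e. e \<in> E \<Longrightarrow> card e = 2"
    "\<And>X. X \<subseteq> V \<Longrightarrow> X \<noteq> {} \<Longrightarrow> card {e\<in>E. e \<subseteq> X} + 2 \<le> 2 * card X"
  using assms finite_edges[of V E] unfolding tight_graph_def simple_graph_def by auto

lemma tight_graph_induced:
  assumes "tight_graph V E" "X \<subseteq> V" "X \<noteq> {}" "card {e\<in>E. e \<subseteq> X} + 2 = 2 * card X"
  shows "tight_graph X {e\<in>E. e \<subseteq> X}"
proof -
  note G = tight_graphD[OF assms(1)]
  have "card {e \<in> {e\<in>E. e \<subseteq> X}. e \<subseteq> Y} + 2 \<le> 2 * card Y" if "Y \<subseteq> X" "Y \<noteq> {}" for Y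
  proof -
    have "{e \<in> {e\<in>E. e \<subseteq> X}. e \<subseteq> Y} = {e\<in>E. e \<subseteq> Y}" using that by auto
    then show ?thesis using G(7)[of Y] that assms by auto
  qed
  then show ?thesis
    using assms G(1,6) finite_subset[of X V] unfolding tight_graph_def simple_graph_def by auto
qed

lemma card_star:
  assumes "tight_graph V E" "v \<in> V"
  shows "card {e\<in>E. v \<in> e} + card {e\<in>E. e \<subseteq> V - {v}} = card E"
    and "card {u. {v, u} \<in> E} = card {e\<in>E. v \<in> e}"
proof -
  note G = tight_graphD[OF assms(1)]
  have "{e\<in>E. v \<in> e} \<union> {e\<in>E. e \<subseteq> V - {v}} = E" using G(5) by blast
  moreover have "{e\<in>E. v \<in> e} \<inter> {e\<in>E. e \<subseteq> V - {v}} = {}" by blast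
  ultimately show "card {e\<in>E. v \<in> e} + card {e\<in>E. e \<subseteq> V - {v}} = card E"
    using card_Un_disjoint[of "{e\<in>E. v \<in> e}" "{e\<in>E. e \<subseteq> V - {v}}"] G(3) by simp
  have "(\<lambda>u. {v, u}) ` {u. {v, u} \<in> E} = {e\<in>E. v \<in> e}"
  proof
    show "{e\<in>E. v \<in> e} \<subseteq> (\<lambda>u. {v, u}) ` {u. {v, u} \<in> E}"
    proof
      fix e assume e: "e \<in> {e\<in>E. v \<in> e}"
      then obtain a b where ab: "e = {a, b}" using G(6)[of e] by (auto simp: card_2_iff)
      then obtain u where "e = {v, u}" using e by blast
      then show "e \<in> (\<lambda>u. {v, u}) ` {u. {v, u} \<in> E}" using e by blast
    qed
  qed auto
  moreover have "inj_on (\<lambda>u. {v, u}) {u. {v, u} \<in> E}" by (rule inj_onI) (metis doubleton_eq_iff)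
  ultimately show "card {u. {v, u} \<in> E} = card {e\<in>E. v \<in> e}"
    using card_image[of "\<lambda>u. {v, u}" "{u. {v, u} \<in> E}"] by simp
qed

lemma tight_graph_edge_ne:
  assumes "tight_graph V E" "{v, u} \<in> E"
  shows "u \<noteq> v" "v \<in> V" "u \<in> V"
  using tight_graphD(5,6)[OF assms] by auto

text \<open>Sparsity of \<open>V - {v}\<close> leaves at least two of the
  \<open>2 * card V - 2\<close> edges at \<open>v\<close>.\<close>

lemma tight_graph_degree_ge_2:
  assumes "tight_graph V E" "v \<in> V" "2 \<le> card V"
  shows "2 \<le> card {e\<in>E. v \<in> e}"
proof -
  note G = tight_graphD[OF assms(1)]
  have "card (V - {v}) + 1 = card V" using G(1) assms by simp
  moreover from this have "V - {v} \<noteq> {}" using assms(3) by (metis card.empty add_0 Suc_1 Suc_n_not_le_n)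
  ultimately show ?thesis using G(7)[of "V - {v}"] G(4) card_star(1)[OF assms(1,2)] by auto
qed

text \<open>The degrees sum to \<open>2 * card E\<close>, that is \<open>4 * card V - 4\<close>, so
  their average is below 4.\<close>

lemma tight_graph_degree_le_3:
  assumes "tight_graph V E"
  shows "\<exists>v\<in>V. card {e\<in>E. v \<in> e} \<le> 3"
proof (rule ccontr)
  note G = tight_graphD[OF assms(1)]
  assume "\<not> ?thesis"
  then have ge: "\<And>v. v \<in> V \<Longrightarrow> 4 \<le> card {e\<in>E. v \<in> e}" by force
  have "card V * 4 \<le> (\<Sum>v\<in>V. card {e\<in>E. v \<in> e})"
    using sum_mono[of V "\<lambda>_. 4" "\<lambda>v. card {e\<in>E. v \<in> e}"] ge by simp
  also have "\<dots> = (\<Sum>v\<in>V. \<Sum>e\<in>E. if v \<in> e then 1 else 0)"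
    using G(3) by (simp add: sum.If_cases Int_def)
  also have "\<dots> = (\<Sum>e\<in>E. \<Sum>v\<in>V. if v \<in> e then 1 else 0)" by (rule sum.swap)
  also have "\<dots> = (\<Sum>e\<in>E. 2)"
  proof (rule sum.cong[OF refl])
    fix e assume e: "e \<in> E"
    then have "V \<inter> e = e" using G(5) by auto
    then show "(\<Sum>v\<in>V. if v \<in> e then 1 else 0) = (2::nat)"
      using G(1) G(6)[OF e] by (simp add: sum.If_cases)
  qed
  finally show False using G(4) by simp
qed

text \<open>The set \<open>W\<close> carries \<open>2 * card W - 2\<close> edges and contraction
  removes \<open>card W - 1\<close> vertices, so the count is preserved. The hypothesis
  \<open>nbr\<close> makes contraction injective on the remaining edges: no two of them become
  parallel and merge in the image.\<close>

lemma tight_graph_contract: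
  assumes T: "tight_graph V E" and W: "W \<subseteq> V" "w \<in> W" "card {e\<in>E. e \<subseteq> W} + 2 = 2 * card W"
    and nbr: "\<And>z a b. z \<in> V - W \<Longrightarrow> a \<in> W \<Longrightarrow> b \<in> W \<Longrightarrow> {z, a} \<in> E \<Longrightarrow> {z, b} \<in> E \<Longrightarrow> a = b"
  shows "tight_graph (insert w (V - W)) ((`) (\<lambda>v. if v \<in> W then w else v) ` {e\<in>E. \<not> e \<subseteq> W})"
proof -
  note G = tight_graphD[OF T]
  define r where "r = (\<lambda>v. if v \<in> W then w else v)"
  define F where "F = {e\<in>E. \<not> e \<subseteq> W}"
  have finF: "finite F" using G(3) unfolding F_def by simp
  have finW: "finite W" using W G(1) finite_subset by blast
  have form: "(\<exists>z a. z \<in> V - W \<and> a \<in> V \<and> a \<noteq> z \<and> e = {z, a})" if "e \<in> F" for e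
  proof -
    obtain a b where ab: "e = {a, b}" "a \<noteq> b" using G(6)[of e] \<open>e \<in> F\<close> by (auto simp: card_2_iff F_def)
    then show ?thesis using that G(5)[of e] unfolding F_def by (auto simp: doubleton_eq_iff)
  qed
  have inj: "inj_on ((`) r) F"
  proof (rule inj_onI)
    fix e e' assume e: "e \<in> F" "e' \<in> F" "r ` e = r ` e'"
    from form[OF e(1)] obtain z a where za: "z \<in> V - W" "a \<in> V" "a \<noteq> z" "e = {z, a}" by blast
    from form[OF e(2)] obtain z' a' where za': "z' \<in> V - W" "a' \<in> V" "a' \<noteq> z'" "e' = {z', a'}" by blast
    have E: "{z, a} \<in> E" "{z', a'} \<in> E" using e za za' unfolding F_def by auto
    have rz: "r z = z" "r z' = z'" "z \<noteq> w" "z' \<noteq> w" using za za' W unfolding r_def by auto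
    have eq: "{z, r a} = {z', r a'}" using e(3) za za' rz by simp
    show "e = e'"
    proof (cases "a \<in> W")
      case True
      then have "{z, w} = {z', r a'}" using eq unfolding r_def by simp
      then have "z = z'" "r a' = w" using rz by (auto simp: doubleton_eq_iff)
      then have "a' \<in> W" using za' W unfolding r_def by (auto split: if_splits)
      then show ?thesis using nbr[OF za(1) True \<open>a' \<in> W\<close>] E za za' \<open>z = z'\<close> by auto
    next
      case False
      then have ra: "r a = a" "a \<noteq> w" using W unfolding r_def by auto
      then have "a' \<notin> W" using eq rz unfolding r_def by (auto simp: doubleton_eq_iff)
      then show ?thesis using eq za za' ra unfolding r_def by simp
    qed
  qed
  have cardE: "card {e\<in>E. e \<subseteq> W} + card F = card E"
  proof -
    have "{e\<in>E. e \<subseteq> W} \<union> F = E" unfolding F_def by auto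
    moreover have "{e\<in>E. e \<subseteq> W} \<inter> F = {}" unfolding F_def by auto
    ultimately show ?thesis using card_Un_disjoint[of "{e\<in>E. e \<subseteq> W}" F] G(3) finF by simp
  qed
  have cardVW: "card (V - W) + card W = card V"
    using W G(1) finW by (simp add: card_Diff_subset card_mono)
  have cardr: "card ((`) r ` F) = card F" by (rule card_image[OF inj])
  have simple: "simple_graph (insert w (V - W)) ((`) r ` F)"
    unfolding simple_graph_def
  proof (intro conjI ballI)
    fix e' assume "e' \<in> (`) r ` F"
    then obtain e where e: "e \<in> F" "e' = r ` e" by auto
    from form[OF e(1)] obtain z a where za: "z \<in> V - W" "a \<in> V" "a \<noteq> z" "e = {z, a}" by blast
    have "r z = z" "z \<noteq> w" using za W unfolding r_def by auto
    then show "e' \<subseteq> insert w (V - W)" "card e' = 2" using za e unfolding r_def by auto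
  qed auto
  have sparse: "card {e\<in>(`) r ` F. e \<subseteq> X} + 2 \<le> 2 * card X"
    if X: "X \<subseteq> insert w (V - W)" "X \<noteq> {}" for X
  proof -
    define F' where "F' = {e\<in>F. r ` e \<subseteq> X}"
    have "{e\<in>(`) r ` F. e \<subseteq> X} = (`) r ` F'" unfolding F'_def by auto
    moreover have "inj_on ((`) r) F'" using inj unfolding F'_def by (rule inj_on_subset) auto
    ultimately have card': "card {e\<in>(`) r ` F. e \<subseteq> X} = card F'" by (simp add: card_image)
    have finX: "finite X" using X G(1) finite_subset by fastforce
    have rX: "u \<in> X" if "u \<notin> W" "r u \<in> X" for u using that unfolding r_def by auto
    show ?thesis
    proof (cases "w \<in> X")
      case False
      have "F' \<subseteq> {e\<in>E. e \<subseteq> X}"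
      proof
        fix e assume e: "e \<in> F'"
        have "u \<notin> W" if "u \<in> e" for u using e that False unfolding F'_def r_def by auto
        then show "e \<in> {e\<in>E. e \<subseteq> X}" using e rX unfolding F'_def F_def by blast
      qed
      then have "card F' \<le> card {e\<in>E. e \<subseteq> X}" using G(3) by (intro card_mono) auto
      moreover have "X \<subseteq> V" using X False by auto
      ultimately show ?thesis using G(7)[OF _ X(2)] unfolding card' by linarith
    next
      case True
      \<comment> \<open>Uncontracting \<open>w\<close> to \<open>W\<close>: sparsity of
        \<open>Y\<close> bounds the edges inside \<open>W\<close> and those of \<open>F'\<close>
        together, and tightness of \<open>W\<close> lets its share be subtracted exactly.\<close>
      define Y where "Y = (X - {w}) \<union> W"
      have disj: "(X - {w}) \<inter> W = {}" using X by auto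
      have "{e\<in>E. e \<subseteq> W} \<union> F' \<subseteq> {e\<in>E. e \<subseteq> Y}"
      proof
        fix e assume e: "e \<in> {e\<in>E. e \<subseteq> W} \<union> F'"
        then have "u \<in> Y" if "u \<in> e" for u
        proof (cases "u \<in> W")
          case False
          then have "e \<in> F'" using e that by auto
          then have "r u \<in> X" using that unfolding F'_def by auto
          then show ?thesis using rX False W unfolding Y_def by auto
        qed (simp add: Y_def)
        then show "e \<in> {e\<in>E. e \<subseteq> Y}" using e unfolding F'_def F_def by auto
      qed
      then have "card ({e\<in>E. e \<subseteq> W} \<union> F') \<le> card {e\<in>E. e \<subseteq> Y}" using G(3) by (intro card_mono) auto
      moreover have "card ({e\<in>E. e \<subseteq> W} \<union> F') = card {e\<in>E. e \<subseteq> W} + card F'"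
        using G(3) by (intro card_Un_disjoint) (auto simp: F'_def F_def)
      moreover have "card {e\<in>E. e \<subseteq> Y} + 2 \<le> 2 * card Y"
        by (rule G(7)) (use X W in \<open>auto simp: Y_def\<close>)
      moreover have "card Y = card (X - {w}) + card W"
        unfolding Y_def using disj finX finW by (intro card_Un_disjoint) auto
      moreover have "card (X - {w}) + 1 = card X"
        using card_Suc_Diff1[OF finX True] by simp
      ultimately show ?thesis using W(3) unfolding card' by linarith
    qed
  qed
  have "card (insert w (V - W)) = card (V - W) + 1" using W G(1) by simp
  then have "card ((`) r ` F) + 2 = 2 * card (insert w (V - W))"
    using cardr cardE cardVW G(4) W(3) by linarith
  then show ?thesis
    using simple sparse G(1) unfolding tight_graph_def F_def r_def by auto
qed

text \<open>Induction on the number of vertices. A vertex of degree 2 is deleted. Otherwise a maximal proper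
  tight subset with at least two vertices can be contracted to a vertex without creating parallel
  edges. If there is no such subset, then at a vertex of degree 3 an inverse edge split is possible
  at any non-adjacent pair of neighbours, and without such a pair the graph is \<open>K\<^sub>4\<close>.\<close>

theorem tight_graph_biconnected_drawing:
  assumes "tight_graph V E"
  shows "\<exists>x y. biconnected_drawing V E x y"
  using assms
proof (induction "card V" arbitrary: V E rule: less_induct)
  case less
  note T = less.prems
  note G = tight_graphD[OF T]
  have ne: "u \<noteq> v" "v \<in> V" "u \<in> V" if "{v, u} \<in> E" for u v
    using tight_graph_edge_ne[OF T that] by auto
  have posV: "0 < card V" using G by auto
  consider (one) "card V = 1" | (deg2) v where "2 \<le> card V" "v \<in> V" "card {e\<in>E. v \<in> e} = 2"
    | (contract) W where "2 \<le> card V" "\<forall>v\<in>V. card {e\<in>E. v \<in> e} \<noteq> 2" "W \<subset> V" "2 \<le> card W"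
        "card {e\<in>E. e \<subseteq> W} + 2 = 2 * card W"
    | (deg3) v where "2 \<le> card V" "v \<in> V" "card {e\<in>E. v \<in> e} = 3"
        "\<And>W. W \<subset> V \<Longrightarrow> 2 \<le> card W \<Longrightarrow> card {e\<in>E. e \<subseteq> W} + 2 \<noteq> 2 * card W"
  proof -
    obtain v where v: "v \<in> V" "card {e\<in>E. v \<in> e} \<le> 3" using tight_graph_degree_le_3[OF T] by blast
    show thesis
    proof (cases "card V = 1")
      case False
      then have V2: "2 \<le> card V" using posV by linarith
      have "card {e\<in>E. v \<in> e} = 2 \<or> card {e\<in>E. v \<in> e} = 3"
        using tight_graph_degree_ge_2[OF T v(1) V2] v(2) by linarith
      then show thesis using deg2 contract deg3[OF V2 v(1)] V2 v by blast
    qed (rule one)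
  qed
  then show ?case
  proof cases
    case one
    then obtain v where "V = {v}" using card_1_singletonE by blast
    then have "biconnected_drawing V E (\<lambda>_. 0) (\<lambda>_. 0)"
      unfolding biconnected_drawing_def sign_connected_def by auto
    then show ?thesis by blast
  next
    case (deg2 v)
    have cV: "card (V - {v}) + 1 = card V" using deg2 G(1) by simp
    have "card {u. {v, u} \<in> E} = 2" using card_star(2)[OF T deg2(2)] deg2(3) by simp
    then obtain a b where ab: "{u. {v, u} \<in> E} = {a, b}" "a \<noteq> b" by (auto simp: card_2_iff)
    then have vab: "{v, a} \<in> E" "{v, b} \<in> E" by auto
    have "tight_graph (V - {v}) {e\<in>E. e \<subseteq> V - {v}}"
    proof (rule tight_graph_induced[OF T])
      show "card {e\<in>E. e \<subseteq> V - {v}} + 2 = 2 * card (V - {v})"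
        using card_star(1)[OF T deg2(2)] deg2(3) G(4) cV by linarith
      show "V - {v} \<noteq> {}" using deg2(1) cV by (metis card.empty add_0 Suc_1 Suc_n_not_le_n)
    qed auto
    then obtain x y where "biconnected_drawing (V - {v}) {e\<in>E. e \<subseteq> V - {v}} x y"
      using less.hyps[of "V - {v}"] cV by (metis less_add_one)
    from biconnected_drawing_add_degree_two[OF this, of v a b E]
    have "\<exists>x y. biconnected_drawing (insert v (V - {v})) E x y"
      using vab ne[OF vab(1)] ne[OF vab(2)] ab(2) G(1) by auto
    then show ?thesis using deg2(2) by (simp add: insert_absorb)
  next
    case (contract W0)
    define S where "S = {W. W \<subset> V \<and> 2 \<le> card W \<and> card {e\<in>E. e \<subseteq> W} + 2 = 2 * card W}"
    have "S \<subseteq> Pow V" unfolding S_def by auto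
    then have "finite S" using G(1) finite_subset by blast
    moreover have "S \<noteq> {}" using contract unfolding S_def by auto
    ultimately
    obtain W where W: "W \<in> S" and max: "\<And>W'. W' \<in> S \<Longrightarrow> W \<subseteq> W' \<Longrightarrow> W = W'"
      using finite_has_maximal[of S] by blast
    have WV: "W \<subset> V" "2 \<le> card W" "card {e\<in>E. e \<subseteq> W} + 2 = 2 * card W" using W unfolding S_def by auto
    have finW: "finite W" using WV G(1) finite_subset by blast
    obtain w where w: "w \<in> W" using WV by fastforce
    \<comment> \<open>Two edges from \<open>z\<close> would make \<open>insert z W\<close> tight as
      well. By maximality it can only be all of \<open>V\<close>, and then counting gives
      \<open>z\<close> degree 2, which this case excludes.\<close>
    have nbr: "a = b" if z: "z \<in> V - W" and a: "a \<in> W" "{z, a} \<in> E" and b: "b \<in> W" "{z, b} \<in> E" for z a b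
    proof (rule ccontr)
      assume "a \<noteq> b"
      have "{e\<in>E. e \<subseteq> W} \<union> {{z, a}, {z, b}} \<subseteq> {e\<in>E. e \<subseteq> insert z W}" using z a b by auto
      then have "card ({e\<in>E. e \<subseteq> W} \<union> {{z, a}, {z, b}}) \<le> card {e\<in>E. e \<subseteq> insert z W}"
        using G(3) by (intro card_mono) auto
      moreover have "card ({e\<in>E. e \<subseteq> W} \<union> {{z, a}, {z, b}}) = card {e\<in>E. e \<subseteq> W} + 2"
        using G(3) z \<open>a \<noteq> b\<close> by (subst card_Un_disjoint) (auto simp: doubleton_eq_iff)
      moreover have cz: "card (insert z W) = card W + 1" using z finW by simp
      moreover have "card {e\<in>E. e \<subseteq> insert z W} + 2 \<le> 2 * card (insert z W)"
        by (rule G(7)) (use z WV in auto)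
      ultimately have eq: "card {e\<in>E. e \<subseteq> insert z W} + 2 = 2 * card (insert z W)" using WV(3) by linarith
      have "insert z W \<notin> S" using max[of "insert z W"] z by auto
      then have V: "V = insert z W" using eq cz WV z unfolding S_def by auto
      then have "V - {z} = W" using z by auto
      then have "card {e\<in>E. z \<in> e} = 2"
        using card_star(1)[OF T, of z] z WV(3) G(4) cz V by auto
      then show False using contract z by auto
    qed
    have "tight_graph W {e\<in>E. e \<subseteq> W}" using tight_graph_induced[OF T _ _ WV(3)] WV(1) w by auto
    moreover have "card W < card V" using WV(1) G(1) by (rule psubset_card_mono[rotated])
    ultimately obtain x0 y0 where inner: "biconnected_drawing W {e\<in>E. e \<subseteq> W} x0 y0"
      using less.hyps by blast
    have "tight_graph (insert w (V - W)) ((`) (\<lambda>v. if v \<in> W then w else v) ` {e\<in>E. \<not> e \<subseteq> W})"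
      by (rule tight_graph_contract[OF T _ w WV(3)]) (use WV(1) nbr in auto)
    moreover have "card (insert w (V - W)) < card V"
    proof -
      have "card (insert w (V - W)) = card (V - W) + 1" using w G(1) by simp
      moreover have "card (V - W) + card W = card V"
        using WV(1) G(1) finW by (simp add: card_Diff_subset card_mono psubset_imp_subset)
      ultimately show ?thesis using WV(2) by linarith
    qed
    ultimately obtain x y where outer: "biconnected_drawing (insert w (V - W))
        ((`) (\<lambda>v. if v \<in> W then w else v) ` {e\<in>E. \<not> e \<subseteq> W}) x y"
      using less.hyps by blast
    show ?thesis
      by (rule biconnected_drawing_blow_up[OF G(1) _ w inner outer]) (use WV(1) G(5,6) in auto)
  next
    case (deg3 v)
    have cV: "card (V - {v}) + 1 = card V" using deg3 G(1) by simp
    have "card {u. {v, u} \<in> E} = 3" using card_star(2)[OF T deg3(2)] deg3(3) by simp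
    then obtain a b c where abc: "{u. {v, u} \<in> E} = {a, b, c}" "a \<noteq> b" "b \<noteq> c" "a \<noteq> c"
      by (auto simp: card_3_iff)
    then have vabc: "{v, a} \<in> E" "{v, b} \<in> E" "{v, c} \<in> E" by auto
    have inV: "a \<in> V - {v}" "b \<in> V - {v}" "c \<in> V - {v}"
      using ne[OF vabc(1)] ne[OF vabc(2)] ne[OF vabc(3)] by auto
    have split: ?thesis
      if ab: "{v, a} \<in> E" "{v, b} \<in> E" "{v, c} \<in> E" "a \<noteq> b" "b \<noteq> c" "a \<noteq> c" "{a, b} \<notin> E" for a b c
    proof -
      define E0 where "E0 = {e\<in>E. e \<subseteq> V - {v}}"
      have abV: "a \<in> V - {v}" "b \<in> V - {v}" "c \<in> V - {v}"
        using ne[OF ab(1)] ne[OF ab(2)] ne[OF ab(3)] by auto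
      have finE0: "finite E0" using G(3) unfolding E0_def by auto
      have nE0: "{a, b} \<notin> E0" using ab unfolding E0_def by auto
      \<comment> \<open>Three edges leave with \<open>v\<close> and the new edge \<open>ab\<close>
        gives one back, which is the required loss of two edges for one vertex.\<close>
      have "card E0 + 3 = card E" using card_star(1)[OF T deg3(2)] deg3(3) unfolding E0_def by linarith
      then have cE: "card (insert {a, b} E0) + 2 = 2 * card (V - {v})"
        using finE0 nE0 G(4) cV by simp
      have sparse: "card {e\<in>insert {a, b} E0. e \<subseteq> X} + 2 \<le> 2 * card X"
        if X: "X \<subseteq> V - {v}" "X \<noteq> {}" for X
      proof -
        have eq: "{e\<in>E0. e \<subseteq> X} = {e\<in>E. e \<subseteq> X}" using X unfolding E0_def by auto
        have le: "card {e\<in>E. e \<subseteq> X} + 2 \<le> 2 * card X" using G(7) X by auto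
        show ?thesis
        proof (cases "{a, b} \<subseteq> X")
          case False
          then have "{e\<in>insert {a, b} E0. e \<subseteq> X} = {e\<in>E. e \<subseteq> X}" using eq by auto
          then show ?thesis using le by simp
        next
          case True
          \<comment> \<open>Only sets containing both \<open>a\<close> and \<open>b\<close> gain an
            edge. They have at least two vertices and are proper in \<open>V\<close>, so by the case
            assumption they are not tight and have room for it.\<close>
          have finX: "finite X" using X G(1) finite_subset by blast
          have "card {a, b} \<le> card X" using True finX card_mono by blast
          then have "2 \<le> card X" using ab by simp
          moreover have "X \<subset> V" using X deg3(2) by auto
          ultimately have "card {e\<in>E. e \<subseteq> X} + 2 \<noteq> 2 * card X" using deg3(4) by blast
          moreover have "{e\<in>insert {a, b} E0. e \<subseteq> X} = insert {a, b} {e\<in>E. e \<subseteq> X}" using eq True by auto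
          moreover have "card (insert {a, b} {e\<in>E. e \<subseteq> X}) \<le> card {e\<in>E. e \<subseteq> X} + 1"
            using G(3) by (simp add: card_insert_if)
          ultimately show ?thesis using le by presburger
        qed
      qed
      have "simple_graph (V - {v}) (insert {a, b} E0)"
        using abV ab(4) G(6) unfolding simple_graph_def E0_def by auto
      then have "tight_graph (V - {v}) (insert {a, b} E0)"
        using cE sparse G(1) unfolding tight_graph_def by blast
      then obtain x y where "biconnected_drawing (V - {v}) (insert {a, b} E0) x y"
        using less.hyps[of "V - {v}"] cV by (metis less_add_one)
      from biconnected_drawing_edge_split[OF this, of v c E]
      have "\<exists>x y. biconnected_drawing (insert v (V - {v})) E x y"
        using ab abV G(1) unfolding E0_def by auto
      then show ?thesis using deg3(2) by (simp add: insert_absorb)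
    qed
    show ?thesis
    proof (cases "{a, b} \<in> E \<and> {a, c} \<in> E \<and> {b, c} \<in> E")
      case False
      then consider "{a, b} \<notin> E" | "{a, c} \<notin> E" | "{b, c} \<notin> E" by blast
      then show ?thesis
      proof cases
        case 1
        show ?thesis by (rule split[OF vabc abc(2-4) 1])
      next
        case 2
        show ?thesis by (rule split[OF vabc(1,3,2) abc(4) abc(3)[symmetric] abc(2) 2])
      next
        case 3
        show ?thesis by (rule split[OF vabc(2,3,1) abc(3) abc(4)[symmetric] abc(2)[symmetric] 3])
      qed
    next
      case True
      \<comment> \<open>With all neighbours pairwise adjacent, \<open>K\<close> spans a complete
        graph with 6 edges, the maximum allowed on 4 vertices. So \<open>K\<close> is tight, and the
        case assumption forbids that it is a proper subset.\<close>
      define K where "K = {v, a, b, c}"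
      have d: "distinct [v, a, b, c]" using inV abc by auto
      have cK: "card K = 4" using d unfolding K_def by simp
      have "{{v, a}, {v, b}, {v, c}, {a, b}, {a, c}, {b, c}} \<subseteq> {e\<in>E. e \<subseteq> K}"
        using vabc True unfolding K_def by auto
      then have "card {{v, a}, {v, b}, {v, c}, {a, b}, {a, c}, {b, c}} \<le> card {e\<in>E. e \<subseteq> K}"
        using G(3) by (intro card_mono) auto
      moreover have "card {{v, a}, {v, b}, {v, c}, {a, b}, {a, c}, {b, c}} = 6"
        using d by (simp add: card_insert_if doubleton_eq_iff)
      moreover have KV: "K \<subseteq> V" using inV deg3(2) unfolding K_def by auto
      then have "card {e\<in>E. e \<subseteq> K} + 2 \<le> 2 * card K" by (rule G(7)) (simp add: K_def)
      ultimately have "card {e\<in>E. e \<subseteq> K} + 2 = 2 * card K" using cK by linarith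
      then have "\<not> K \<subset> V" using deg3(4)[of K] cK by auto
      then have "V = {v, a, b, c}" using KV unfolding K_def by blast
      then show ?thesis using biconnected_drawing_K4[OF d vabc] True by simp
    qed
  qed
qed

section \<open>The geometry of the unit ball\<close>

text \<open>Both vectors lie on the line orthogonal to \<open>m\<close>. Their dependence is written
  with a test vector \<open>k\<close>, so that no proportionality factor or division
  appears.\<close>

lemma planar_parallel:
  fixes m a b k :: "real^2"
  assumes "m \<noteq> 0" "m \<bullet> a = 0" "m \<bullet> b = 0"
  shows "(b \<bullet> k) *\<^sub>R a = (a \<bullet> k) *\<^sub>R b"
proof -
  have eq: "m$1 * a$1 + m$2 * a$2 = 0" "m$1 * b$1 + m$2 * b$2 = 0"
    using assms(2,3) by (simp_all add: inner_vec_def sum_2)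
  have "m$1 * (a$1 * b$2 - a$2 * b$1) = (m$1 * a$1 + m$2 * a$2) * b$2 - (m$1 * b$1 + m$2 * b$2) * a$2"
    "m$2 * (a$1 * b$2 - a$2 * b$1) = (m$1 * b$1 + m$2 * b$2) * a$1 - (m$1 * a$1 + m$2 * a$2) * b$1"
    by (simp_all add: algebra_simps)
  then have "m$1 * (a$1 * b$2 - a$2 * b$1) = 0" "m$2 * (a$1 * b$2 - a$2 * b$1) = 0"
    unfolding eq by simp_all
  moreover have "m$1 \<noteq> 0 \<or> m$2 \<noteq> 0" using assms(1) by (auto simp: vec_eq_iff forall_2)
  ultimately have det: "a$1 * b$2 = a$2 * b$1" by auto
  have "(b$1 * k$1 + b$2 * k$2) * a$1 = (a$1 * k$1 + a$2 * k$2) * b$1 + (a$1 * b$2 - a$2 * b$1) * k$2"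
    "(b$1 * k$1 + b$2 * k$2) * a$2 = (a$1 * k$1 + a$2 * k$2) * b$2 - (a$1 * b$2 - a$2 * b$1) * k$1"
    by (simp_all add: algebra_simps)
  then show ?thesis using det by (simp add: vec_eq_iff forall_2 inner_vec_def sum_2)
qed

lemma planar_orthogonal_exists:
  fixes x :: "real^2"
  assumes "x \<noteq> 0"
  obtains y where "y \<noteq> 0" "x \<bullet> y = 0"
proof
  show "vector [- x$2, x$1] \<noteq> (0 :: real^2)" using assms by (auto simp: vec_eq_iff forall_2)
  show "x \<bullet> vector [- x$2, x$1] = 0" by (simp add: inner_vec_def sum_2)
qed

text \<open>Scaling the normal to the value 1 on the facet is possible because the origin is
  interior. These normals are the vertices of the polar polygon, and the norm is the maximum of the
  functionals they define.\<close>

definition facet_normal :: "(real^2) set \<Rightarrow> (real^2) set \<Rightarrow> real^2" where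
  "facet_normal P F = (SOME n. P \<subseteq> {x. n \<bullet> x \<le> 1} \<and> F = P \<inter> {x. n \<bullet> x = 1})"

text \<open>The functional of \<open>F\<close> strictly beats all others at \<open>d\<close>: the
  vector is interior to the cone of \<open>F\<close>, and the norm is linear near it.\<close>

definition facet_direction :: "(real^2) set \<Rightarrow> (real^2) set \<Rightarrow> real^2 \<Rightarrow> bool" where
  "facet_direction P F d \<longleftrightarrow> F facet_of P \<and> 0 < facet_normal P F \<bullet> d \<and>
     (\<forall>F'. F' facet_of P \<and> F' \<noteq> F \<longrightarrow> facet_normal P F' \<bullet> d < facet_normal P F \<bullet> d)"

locale planar_unit_ball =
  fixes P :: "(real^2) set"
  assumes P: "symmetric_polytope2 P"
begin

abbreviation "nrm \<equiv> facet_normal P"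

lemma polytope: "polytope P" and symmetric: "x \<in> P \<Longrightarrow> - x \<in> P" and convex: "convex P"
  using P polytope_imp_convex unfolding symmetric_polytope2_def by (auto simp: image_iff)

lemma interior_eq: "rel_interior P = interior P"
  using P unfolding symmetric_polytope2_def by (intro rel_interior_interior) (simp add: affine_hull_UNIV aff_dim_eq_full)

lemma zero_in_interior: "0 \<in> interior P"
proof -
  have "P \<noteq> {}" using P unfolding symmetric_polytope2_def by auto
  then obtain x where x: "x \<in> interior P"
    using rel_interior_eq_empty[OF convex] interior_eq by blast
  have "uminus ` P = P" using P unfolding symmetric_polytope2_def by auto
  then have "- x \<in> interior P" using x interior_negations[of P] by auto
  then have "(1/2) *\<^sub>R x + (1/2) *\<^sub>R (- x) \<in> interior P"
    using x convex_interior[OF convex] by (intro convexD) auto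
  then show ?thesis by simp
qed

lemma zero_in: "0 \<in> P"
  using zero_in_interior interior_subset by blast

lemma finite_facets: "finite {F. F facet_of P}"
  by (rule finite_polytope_facets[OF polytope])

lemma boundary: "x \<in> P \<Longrightarrow> x \<notin> interior P \<Longrightarrow> \<exists>F. F facet_of P \<and> x \<in> F"
  using rel_boundary_of_polyhedron[OF polytope_imp_polyhedron[OF polytope]] interior_eq by blast

lemma facet_normal:
  assumes "F facet_of P"
  shows "\<And>x. x \<in> P \<Longrightarrow> nrm F \<bullet> x \<le> 1" and "F = P \<inter> {x. nrm F \<bullet> x = 1}"
proof -
  have face: "F face_of P" "F \<noteq> P" using assms unfolding facet_of_def by auto
  then have "F exposed_face_of P"
    using exposed_face_of_polyhedron[OF polytope_imp_polyhedron[OF polytope]] by blast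
  then obtain a b where ab: "P \<subseteq> {x. a \<bullet> x \<le> b}" "F = P \<inter> {x. a \<bullet> x = b}"
    unfolding exposed_face_of_def by blast
  have "0 \<le> b" using ab(1) zero_in by auto
  \<comment> \<open>For \<open>b = 0\<close>, symmetry would force the functional of
    \<open>a\<close> to vanish on all of \<open>P\<close>, and the face would be \<open>P\<close>
    itself.\<close>
  moreover have "b \<noteq> 0"
  proof
    assume "b = 0"
    have "a \<bullet> x = 0" if "x \<in> P" for x
      using subsetD[OF ab(1) that] subsetD[OF ab(1) symmetric[OF that]] \<open>b = 0\<close> by simp
    then show False using face ab(2) \<open>b = 0\<close> by auto
  qed
  ultimately have "0 < b" by simp
  then have "P \<subseteq> {x. (a /\<^sub>R b) \<bullet> x \<le> 1} \<and> F = P \<inter> {x. (a /\<^sub>R b) \<bullet> x = 1}"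
    using ab by (auto simp: field_simps)
  then have *: "P \<subseteq> {x. nrm F \<bullet> x \<le> 1} \<and> F = P \<inter> {x. nrm F \<bullet> x = 1}"
    unfolding facet_normal_def by (rule someI)
  then show "\<And>x. x \<in> P \<Longrightarrow> nrm F \<bullet> x \<le> 1" "F = P \<inter> {x. nrm F \<bullet> x = 1}" by auto
qed

lemma facet_normal_inj: "F facet_of P \<Longrightarrow> F' facet_of P \<Longrightarrow> nrm F = nrm F' \<Longrightarrow> F = F'"
  using facet_normal(2) by metis

text \<open>The ray through \<open>x\<close> leaves \<open>P\<close> at a boundary point
  \<open>z\<close> on some facet \<open>F\<close>. The ratio of \<open>x\<close> to \<open>z\<close>
  is admissible in the infimum, and the functional of \<open>F\<close> shows that nothing smaller
  is.\<close>

lemma poly_norm_witness: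
  assumes "x \<noteq> 0"
  obtains F z where "F facet_of P" "z \<in> F" "0 < poly_norm P x" "x = poly_norm P x *\<^sub>R z"
    "nrm F \<bullet> x = poly_norm P x"
proof -
  obtain d where d: "0 < d" "0 + d *\<^sub>R x \<in> frontier P"
    using ray_to_frontier[OF polytope_imp_bounded[OF polytope] zero_in_interior assms] by blast
  then have "d *\<^sub>R x \<in> P" "d *\<^sub>R x \<notin> interior P"
    using polytope_imp_closed[OF polytope] unfolding frontier_def by auto
  then obtain F where F: "F facet_of P" "d *\<^sub>R x \<in> F" using boundary by blast
  then have "nrm F \<bullet> (d *\<^sub>R x) = 1" using facet_normal(2) by blast
  then have n: "nrm F \<bullet> x = 1 / d" using d(1) by (simp add: field_simps)
  have "1 / d \<le> l" if l: "0 \<le> l" "x \<in> (\<lambda>y. l *\<^sub>R y) ` P" for l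
  proof -
    obtain y where y: "y \<in> P" "x = l *\<^sub>R y" using l(2) by blast
    have "1 / d = l * (nrm F \<bullet> y)" using n y by simp
    then show ?thesis using mult_left_mono[OF facet_normal(1)[OF F(1) y(1)] l(1)] by simp
  qed
  moreover have "1 / d \<in> {l. 0 \<le> l \<and> x \<in> (\<lambda>y. l *\<^sub>R y) ` P}"
    using d(1) \<open>d *\<^sub>R x \<in> P\<close> by (auto intro!: image_eqI[of _ _ "d *\<^sub>R x"])
  ultimately have "poly_norm P x = 1 / d"
    unfolding poly_norm_def by (intro cInf_eq_minimum) auto
  then show thesis using that[OF F] d(1) n by simp
qed

lemma facet_normal_le_poly_norm:
  assumes "x \<noteq> 0" "F facet_of P"
  shows "nrm F \<bullet> x \<le> poly_norm P x"
proof -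
  obtain F' z where z: "F' facet_of P" "z \<in> F'" "0 < poly_norm P x" "x = poly_norm P x *\<^sub>R z"
    using poly_norm_witness[OF assms(1)] by metis
  have "z \<in> P" using z facet_normal(2) by blast
  have "nrm F \<bullet> x = poly_norm P x * (nrm F \<bullet> z)" by (subst z(4)) simp
  also have "\<dots> \<le> poly_norm P x * 1"
    using facet_normal(1)[OF assms(2) \<open>z \<in> P\<close>] z(3) by (intro mult_left_mono) auto
  finally show ?thesis by simp
qed

lemma poly_norm_minus: "poly_norm P (- x) = poly_norm P x"
proof -
  have *: "- x \<in> (\<lambda>y. l *\<^sub>R y) ` P" if "x \<in> (\<lambda>y. l *\<^sub>R y) ` P" for x l
  proof -
    from that obtain y where "x = l *\<^sub>R y" "y \<in> P" by (rule imageE)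
    then show ?thesis using symmetric by (intro image_eqI[of _ _ "- y"]) simp_all
  qed
  have "- x \<in> (\<lambda>y. l *\<^sub>R y) ` P \<longleftrightarrow> x \<in> (\<lambda>y. l *\<^sub>R y) ` P" for l
    using *[of x l] *[of "- x" l] by auto
  then show ?thesis unfolding poly_norm_def by simp
qed

lemma mem_if_facet_normals_le:
  assumes "\<And>F. F facet_of P \<Longrightarrow> nrm F \<bullet> x \<le> 1"
  shows "x \<in> P"
proof (cases "x = 0")
  case False
  then obtain F z where z: "F facet_of P" "z \<in> F" "0 < poly_norm P x" "x = poly_norm P x *\<^sub>R z"
    "nrm F \<bullet> x = poly_norm P x"
    using poly_norm_witness by metis
  have "poly_norm P x \<le> 1" using assms[OF z(1)] z(5) by simp
  moreover have "z \<in> P" using z(2) facet_normal(2)[OF z(1)] by blast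
  ultimately have "(1 - poly_norm P x) *\<^sub>R 0 + poly_norm P x *\<^sub>R z \<in> P"
    using z(3) zero_in by (intro convexD[OF convex]) auto
  then show ?thesis by (simp flip: z(4))
qed (simp add: zero_in)

text \<open>The cone of \<open>F\<close> is the region where \<open>F\<close> attains the maximum
  defining the norm. On points of \<open>F\<close> its own functional is 1 and the others are at
  most 1, so none of them exceeds it on a nonnegative combination.\<close>

lemma nonneg_combinations_facet:
  assumes "d \<noteq> 0" "F facet_of P"
  shows "d \<in> nonneg_combinations F \<longleftrightarrow> nrm F \<bullet> d = poly_norm P d"
proof
  assume "d \<in> nonneg_combinations F"
  then obtain S c where S: "finite S" "S \<subseteq> F" "\<forall>x\<in>S. 0 \<le> c x" "d = (\<Sum>x\<in>S. c x *\<^sub>R x)"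
    unfolding nonneg_combinations_def by blast
  have n: "nrm G \<bullet> d = (\<Sum>x\<in>S. c x * (nrm G \<bullet> x))" for G
    unfolding S(4) by (simp add: inner_sum_right)
  obtain G where G: "G facet_of P" "nrm G \<bullet> d = poly_norm P d"
    using poly_norm_witness[OF assms(1)] by metis
  have "nrm F \<bullet> x = 1" "x \<in> P" if "x \<in> S" for x using facet_normal(2)[OF assms(2)] S(2) that by auto
  then have "nrm G \<bullet> d \<le> nrm F \<bullet> d"
    unfolding n using S(3) facet_normal(1)[OF G(1)] by (intro sum_mono mult_left_mono) auto
  then show "nrm F \<bullet> d = poly_norm P d" using facet_normal_le_poly_norm[OF assms] G by simp
next
  assume eq: "nrm F \<bullet> d = poly_norm P d"
  obtain G z where z: "G facet_of P" "z \<in> G" "0 < poly_norm P d" "d = poly_norm P d *\<^sub>R z"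
    using poly_norm_witness[OF assms(1)] by metis
  have "poly_norm P d * (nrm F \<bullet> z) = nrm F \<bullet> d" by (subst (2) z(4)) simp
  then have "nrm F \<bullet> z = 1" using eq z(3) by simp
  moreover have "z \<in> P" using z facet_normal(2) by blast
  ultimately have "z \<in> F" using facet_normal(2)[OF assms(2)] by auto
  then show "d \<in> nonneg_combinations F"
    unfolding nonneg_combinations_def using z
    by (intro CollectI exI[of _ "{z}"] exI[of _ "\<lambda>_. poly_norm P d"]) auto
qed

section \<open>Directions in which the norm is linear\<close>

lemma facet_direction_poly_norm:
  assumes "facet_direction P F d"
  shows "d \<noteq> 0" "poly_norm P d = nrm F \<bullet> d"
proof -
  show "d \<noteq> 0" using assms unfolding facet_direction_def by auto
  then obtain G where G: "G facet_of P" "nrm G \<bullet> d = poly_norm P d"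
    using poly_norm_witness by metis
  have "nrm F \<bullet> d \<le> nrm G \<bullet> d"
    using facet_normal_le_poly_norm[OF \<open>d \<noteq> 0\<close>, of F] G assms unfolding facet_direction_def by simp
  then have "G = F" using assms G(1) unfolding facet_direction_def by force
  then show "poly_norm P d = nrm F \<bullet> d" using G by simp
qed

lemma facet_direction_iff:
  assumes "d \<noteq> 0"
  shows "(\<exists>!F. F facet_of P \<and> d \<in> nonneg_combinations F) \<longleftrightarrow> (\<exists>F. facet_direction P F d)"
proof
  assume "\<exists>!F. F facet_of P \<and> d \<in> nonneg_combinations F"
  then obtain F where F: "F facet_of P" "nrm F \<bullet> d = poly_norm P d"
    and uniq: "\<And>G. G facet_of P \<Longrightarrow> nrm G \<bullet> d = poly_norm P d \<Longrightarrow> G = F"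
    using nonneg_combinations_facet[OF assms] by metis
  have "0 < poly_norm P d" using poly_norm_witness[OF assms] by metis
  moreover have "nrm G \<bullet> d < nrm F \<bullet> d" if "G facet_of P" "G \<noteq> F" for G
    using facet_normal_le_poly_norm[OF assms that(1)] uniq[OF that(1)] that(2) F(2) by fastforce
  ultimately show "\<exists>F. facet_direction P F d" using F unfolding facet_direction_def by (intro exI[of _ F]) simp
next
  assume "\<exists>F. facet_direction P F d"
  then obtain F where F: "facet_direction P F d" by blast
  show "\<exists>!F. F facet_of P \<and> d \<in> nonneg_combinations F"
  proof (rule ex1I[of _ F])
    show "F facet_of P \<and> d \<in> nonneg_combinations F"
      using F nonneg_combinations_facet[OF assms] facet_direction_poly_norm[OF F]
      unfolding facet_direction_def by auto
    show "G = F" if "G facet_of P \<and> d \<in> nonneg_combinations G" for G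
      using that F nonneg_combinations_facet[OF assms] facet_direction_poly_norm[OF F]
      unfolding facet_direction_def by fastforce
  qed
qed

text \<open>Competitors that lose at the limit \<open>d\<close> also lose nearby by continuity. The
  second alternative covers ties at \<open>d\<close>, which occur when \<open>d\<close> is a
  multiple of an extreme point and a tilt has to break them.\<close>

lemma eventually_facet_direction:
  assumes lim: "(f \<longlongrightarrow> d) net" and F: "F facet_of P" "0 < nrm F \<bullet> d"
    and less: "\<And>G. G facet_of P \<Longrightarrow> G \<noteq> F \<Longrightarrow>
      nrm G \<bullet> d < nrm F \<bullet> d \<or> (\<forall>\<^sub>F t in net. nrm G \<bullet> f t < nrm F \<bullet> f t)"
  shows "\<forall>\<^sub>F t in net. facet_direction P F (f t)"
proof -
  have lim': "((\<lambda>t. nrm G \<bullet> f t) \<longlongrightarrow> nrm G \<bullet> d) net" for G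
    by (intro tendsto_intros lim)
  have "\<forall>\<^sub>F t in net. \<forall>G\<in>{G. G facet_of P}. G \<noteq> F \<longrightarrow> nrm G \<bullet> f t < nrm F \<bullet> f t"
  proof (rule eventually_ball_finite[OF finite_facets], intro ballI)
    fix G assume G: "G \<in> {G. G facet_of P}"
    show "\<forall>\<^sub>F t in net. G \<noteq> F \<longrightarrow> nrm G \<bullet> f t < nrm F \<bullet> f t"
    proof (cases "G = F")
      case False
      then consider "nrm G \<bullet> d < nrm F \<bullet> d" | "\<forall>\<^sub>F t in net. nrm G \<bullet> f t < nrm F \<bullet> f t"
        using less[of G] G by blast
      then have "\<forall>\<^sub>F t in net. nrm G \<bullet> f t < nrm F \<bullet> f t"
      proof cases
        case 1
        then have "0 < nrm F \<bullet> d - nrm G \<bullet> d" by simp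
        from order_tendstoD(1)[OF tendsto_diff[OF lim' lim'] this] show ?thesis
          by eventually_elim simp
      qed
      then show ?thesis by eventually_elim simp
    qed simp
  qed
  moreover have "\<forall>\<^sub>F t in net. 0 < nrm F \<bullet> f t" by (rule order_tendstoD(1)[OF lim' F(2)])
  ultimately show ?thesis by eventually_elim (use F in \<open>auto simp: facet_direction_def\<close>)
qed

text \<open>Close to \<open>d\<close> the norm coincides with the functional of \<open>F\<close>, so
  the difference equals \<open>(nrm F \<bullet> h) * t\<close>, which is o(t) only if the
  coefficient vanishes.\<close>

lemma poly_norm_smallo_iff:
  assumes "facet_direction P F d"
  shows "(\<lambda>t::real. poly_norm P (d + t *\<^sub>R h) - poly_norm P d) \<in> o[at 0](\<lambda>t. t) \<longleftrightarrow> nrm F \<bullet> h = 0"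
proof -
  have "((\<lambda>t::real. d + t *\<^sub>R h) \<longlongrightarrow> d) (at 0)" by (auto intro!: tendsto_eq_intros)
  then have "\<forall>\<^sub>F t in at 0. facet_direction P F (d + t *\<^sub>R h)"
    by (rule eventually_facet_direction) (use assms in \<open>auto simp: facet_direction_def\<close>)
  then have "\<forall>\<^sub>F t in at 0. poly_norm P (d + t *\<^sub>R h) - poly_norm P d = (nrm F \<bullet> h) * t"
  proof eventually_elim
    case (elim t)
    show ?case
      unfolding facet_direction_poly_norm(2)[OF elim] facet_direction_poly_norm(2)[OF assms]
      by (simp add: inner_add_right)
  qed
  from landau_o.small.in_cong[OF this]
  have "(\<lambda>t. poly_norm P (d + t *\<^sub>R h) - poly_norm P d) \<in> o[at 0](\<lambda>t. t) \<longleftrightarrow>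
      (\<lambda>t. (nrm F \<bullet> h) * t) \<in> o[at 0](\<lambda>t. t)" .
  also have "\<dots> \<longleftrightarrow> nrm F \<bullet> h = 0"
  proof (cases "nrm F \<bullet> h = 0")
    case False
    have "\<not> (\<forall>\<^sub>F t in at (0::real). t = 0)"
    proof
      assume "\<forall>\<^sub>F t in at (0::real). t = 0"
      then have "\<forall>\<^sub>F t in at (0::real). False"
        using eventually_neq_at_within[of 0 "0::real" UNIV] by eventually_elim simp
      then show False by simp
    qed
    then show ?thesis using False by (simp add: landau_o.small_refl_iff)
  qed simp
  finally show ?thesis .
qed

lemma facet_uminus:
  assumes "F facet_of P"
  shows "uminus ` F facet_of P"
proof -
  have sym: "uminus ` P = P" using P unfolding symmetric_polytope2_def by auto
  have lin: "linear (uminus :: real^2 \<Rightarrow> real^2)" by (simp add: linear_uminus)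
  have "uminus ` F face_of uminus ` P"
    using assms unfolding facet_of_def by (subst face_of_linear_image[OF lin]) auto
  moreover have "aff_dim (uminus ` F) = aff_dim F"
    by (rule aff_dim_injective_linear_image[OF lin]) auto
  ultimately show ?thesis using assms sym unfolding facet_of_def by simp
qed

lemma nonneg_combinations_uminus:
  assumes "d \<in> nonneg_combinations F"
  shows "- d \<in> nonneg_combinations (uminus ` F)"
proof -
  obtain S c where S: "finite S" "S \<subseteq> F" "\<forall>x\<in>S. 0 \<le> c x" "d = (\<Sum>x\<in>S. c x *\<^sub>R x)"
    using assms unfolding nonneg_combinations_def by blast
  have "- d = (\<Sum>x\<in>uminus ` S. c (- x) *\<^sub>R x)"
    unfolding S(4) by (subst sum.reindex) (auto simp: sum_negf)
  then show ?thesis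
    unfolding nonneg_combinations_def using S(1-3)
    by (intro CollectI exI[of _ "uminus ` S"] exI[of _ "\<lambda>x. c (- x)"]) auto
qed

text \<open>The placement is analysed along edges oriented towards larger \<open>x\<close>. This
  transfers the result to the opposite orientation, over which \<open>well_positioned\<close>
  quantifies too.\<close>

lemma unique_facet_uminus:
  assumes "\<exists>!F. F facet_of P \<and> d \<in> nonneg_combinations F"
  shows "\<exists>!F. F facet_of P \<and> - d \<in> nonneg_combinations F"
proof -
  obtain F where F: "F facet_of P" "d \<in> nonneg_combinations F"
    and uniq: "\<And>G. G facet_of P \<Longrightarrow> d \<in> nonneg_combinations G \<Longrightarrow> G = F"
    using assms by blast
  show ?thesis
  proof (rule ex1I[of _ "uminus ` F"])
    show "uminus ` F facet_of P \<and> - d \<in> nonneg_combinations (uminus ` F)"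
      using F facet_uminus nonneg_combinations_uminus by blast
    fix G assume G: "G facet_of P \<and> - d \<in> nonneg_combinations G"
    then have "uminus ` G = F"
      using uniq facet_uminus nonneg_combinations_uminus[of "- d" G] by auto
    then show "G = uminus ` F" by (auto simp: image_image)
  qed
qed

text \<open>At an extreme point \<open>x0\<close> at least two facets meet; their normals are distinguished by the
  inner product with a vector \<open>y0\<close> orthogonal to \<open>x0\<close>, so moving from \<open>x0\<close> slightly along \<open>y0\<close>
  or \<open>-y0\<close> enters the cone of exactly one facet.\<close>

lemma two_facets_at_extreme_point:
  obtains F1 F2 x0 y0 where "F1 facet_of P" "F2 facet_of P" "nrm F1 \<bullet> x0 = 1" "nrm F2 \<bullet> x0 = 1"
    "\<forall>F. F facet_of P \<longrightarrow> nrm F \<bullet> x0 \<le> 1"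
    "\<forall>F. F facet_of P \<and> F \<noteq> F1 \<and> nrm F \<bullet> x0 = 1 \<longrightarrow> nrm F \<bullet> y0 < nrm F1 \<bullet> y0"
    "\<forall>F. F facet_of P \<and> F \<noteq> F2 \<and> nrm F \<bullet> x0 = 1 \<longrightarrow> nrm F2 \<bullet> y0 < nrm F \<bullet> y0"
    "\<forall>u. nrm F1 \<bullet> u = 0 \<and> nrm F2 \<bullet> u = 0 \<longrightarrow> u = 0"
proof -
  have "compact P" "P \<noteq> {}" using polytope_imp_compact[OF polytope] zero_in by auto
  then obtain x0 where ext: "x0 extreme_point_of P" using extreme_point_exists_convex convex by blast
  have x0: "x0 \<in> P" "x0 \<notin> interior P"
    using ext extreme_point_not_in_interior extreme_point_of_def by blast+
  then have "x0 \<noteq> 0" using zero_in_interior by auto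
  then obtain y0 where y0: "y0 \<noteq> 0" "x0 \<bullet> y0 = 0" using planar_orthogonal_exists by blast
  define A where "A = {F. F facet_of P \<and> nrm F \<bullet> x0 = 1}"
  have fin: "finite A" using finite_facets unfolding A_def by auto
  obtain F0 where "F0 facet_of P" "x0 \<in> F0" using boundary x0 by blast
  then have F0: "F0 \<in> A" using facet_normal(2) unfolding A_def by blast
  \<comment> \<open>Otherwise the difference of two normals would be orthogonal to both
    \<open>x0\<close> and \<open>y0\<close>, which would make these orthogonal vectors
    parallel.\<close>
  have inj: "F = G" if FG: "F \<in> A" "G \<in> A" "nrm F \<bullet> y0 = nrm G \<bullet> y0" for F G
  proof (rule ccontr)
    assume "F \<noteq> G"
    then have ne: "nrm F - nrm G \<noteq> 0" using FG facet_normal_inj unfolding A_def by auto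
    have "(nrm F - nrm G) \<bullet> x0 = 0" "(nrm F - nrm G) \<bullet> y0 = 0"
      using FG unfolding A_def by (simp_all add: inner_diff_left)
    from planar_parallel[OF ne this, of y0] have "(y0 \<bullet> y0) *\<^sub>R x0 = 0" using y0(2) by simp
    then show False using y0(1) \<open>x0 \<noteq> 0\<close> by simp
  qed
  define F1 where "F1 = arg_min_on (\<lambda>F. - (nrm F \<bullet> y0)) A"
  define F2 where "F2 = arg_min_on (\<lambda>F. nrm F \<bullet> y0) A"
  have F1: "F1 \<in> A" "\<And>F. F \<in> A \<Longrightarrow> nrm F \<bullet> y0 \<le> nrm F1 \<bullet> y0"
    using arg_min_if_finite[OF fin, of "\<lambda>F. - (nrm F \<bullet> y0)"] F0
    unfolding F1_def by (auto simp: not_less)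
  have F2: "F2 \<in> A" "\<And>F. F \<in> A \<Longrightarrow> nrm F2 \<bullet> y0 \<le> nrm F \<bullet> y0"
    using arg_min_if_finite[OF fin, of "\<lambda>F. nrm F \<bullet> y0"] F0
    unfolding F2_def by (auto simp: not_less)
  have "F1 \<noteq> F2"
  proof
    assume eq: "F1 = F2"
    have single: "F = F1" if "F \<in> A" for F
      using inj[OF that F1(1)] F1(2)[OF that] F2(2)[OF that] eq by simp
    have "nrm F1 \<noteq> 0" using F1(1) unfolding A_def by auto
    \<comment> \<open>Here \<open>w\<close> is the direction along the only facet through
      \<open>x0\<close>. All other facet inequalities are strict at \<open>x0\<close>, so
      \<open>x0\<close> could move both ways along \<open>w\<close> inside \<open>P\<close>, against
      extremality.\<close>
    then obtain w where w: "w \<noteq> 0" "nrm F1 \<bullet> w = 0" using planar_orthogonal_exists by blast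
    have tilt: "\<forall>\<^sub>F t in at_right (0::real). \<forall>F\<in>{F. F facet_of P}. nrm F \<bullet> (x0 + (t * s) *\<^sub>R w) \<le> 1" for s
    proof (rule eventually_ball_finite[OF finite_facets], intro ballI)
      fix F assume F: "F \<in> {F. F facet_of P}"
      show "\<forall>\<^sub>F t in at_right 0. nrm F \<bullet> (x0 + (t * s) *\<^sub>R w) \<le> 1"
      proof (cases "F = F1")
        case True
        then show ?thesis using w F1(1) unfolding A_def by (simp add: inner_add_right)
      next
        case False
        then have "F \<notin> A" using single by blast
        then have "nrm F \<bullet> x0 < 1" using facet_normal(1)[OF _ x0(1)] F unfolding A_def by fastforce
        moreover have "((\<lambda>t. nrm F \<bullet> (x0 + (t * s) *\<^sub>R w)) \<longlongrightarrow> nrm F \<bullet> x0) (at_right 0)"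
          by (auto intro!: tendsto_eq_intros)
        ultimately show ?thesis using order_tendstoD(2) by (fastforce elim: eventually_mono)
      qed
    qed
    have pos: "\<forall>\<^sub>F t in at_right 0. 0 < (t::real)" by (simp add: eventually_at_filter)
    from eventually_happens'[OF trivial_limit_at_right_real
        eventually_conj[OF pos eventually_conj[OF tilt[of 1] tilt[of "-1"]]]]
    obtain t where t: "0 < t" "\<forall>F\<in>{F. F facet_of P}. nrm F \<bullet> (x0 + (t * 1) *\<^sub>R w) \<le> 1"
      "\<forall>F\<in>{F. F facet_of P}. nrm F \<bullet> (x0 + (t * -1) *\<^sub>R w) \<le> 1" by blast
    have "x0 + (t * 1) *\<^sub>R w \<in> P" "x0 + (t * -1) *\<^sub>R w \<in> P"
      using t(2,3) by (auto intro!: mem_if_facet_normals_le)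
    moreover have "x0 \<in> open_segment (x0 + (t * 1) *\<^sub>R w) (x0 + (t * -1) *\<^sub>R w)"
    proof -
      have "x0 = midpoint (x0 + (t * 1) *\<^sub>R w) (x0 + (t * -1) *\<^sub>R w)"
        by (simp add: midpoint_def scaleR_2[symmetric])
      moreover have "x0 + (t * 1) *\<^sub>R w \<noteq> x0 + (t * -1) *\<^sub>R w"
      proof
        assume "x0 + (t * 1) *\<^sub>R w = x0 + (t * -1) *\<^sub>R w"
        then have "(t * 1) *\<^sub>R w = (t * -1) *\<^sub>R w" by (rule add_left_imp_eq)
        then show False using t(1) w(1) unfolding scaleR_cancel_right by simp
      qed
      ultimately show ?thesis by (metis midpoint_in_open_segment)
    qed
    ultimately show False using ext unfolding extreme_point_of_def by blast
  qed
  show thesis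
  proof (rule that[of F1 F2 x0 y0]; (intro allI impI, (elim conjE)?)?)
    show "F1 facet_of P" "F2 facet_of P" "nrm F1 \<bullet> x0 = 1" "nrm F2 \<bullet> x0 = 1"
      using F1 F2 unfolding A_def by auto
    show "nrm F \<bullet> x0 \<le> 1" if "F facet_of P" for F using that facet_normal(1) x0(1) by blast
    show "nrm F \<bullet> y0 < nrm F1 \<bullet> y0" if "F facet_of P" "F \<noteq> F1" "nrm F \<bullet> x0 = 1" for F
      using inj[of F F1] F1 that unfolding A_def by fastforce
    show "nrm F2 \<bullet> y0 < nrm F \<bullet> y0" if "F facet_of P" "F \<noteq> F2" "nrm F \<bullet> x0 = 1" for F
      using inj[of F F2] F2 that unfolding A_def by fastforce
    show "u = 0" if u: "nrm F1 \<bullet> u = 0" "nrm F2 \<bullet> u = 0" for u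
    proof -
      have ne: "nrm F1 - nrm F2 \<noteq> 0"
        using F1(1) F2(1) \<open>F1 \<noteq> F2\<close> facet_normal_inj unfolding A_def by auto
      have "(nrm F1 - nrm F2) \<bullet> x0 = 0" "(nrm F1 - nrm F2) \<bullet> u = 0"
        using F1(1) F2(1) u unfolding A_def by (simp_all add: inner_diff_left)
      \<comment> \<open>This gives \<open>(u \<bullet> nrm F1) *\<^sub>R x0 = (x0 \<bullet> nrm F1)
        *\<^sub>R u\<close>, that is \<open>0 = u\<close>.\<close>
      from planar_parallel[OF ne this, of "nrm F1"]
      show ?thesis using u(1) F1(1) unfolding A_def by (simp add: inner_commute)
    qed
  qed
qed

end

section \<open>Rigid frameworks\<close>

lemma incidence_sum:
  fixes m :: "real^2" and u :: "'a \<Rightarrow> real^2"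
  assumes "finite W" "a \<in> W \<or> u a = 0" "b \<in> W \<or> u b = 0"
  shows "(\<Sum>(v, i)\<in>W \<times> UNIV. m $ i * (of_bool (v = a) - of_bool (v = b)) * (u v $ i)) = m \<bullet> (u a - u b)"
proof -
  have single: "(\<Sum>v\<in>W. of_bool (v = a) * (m \<bullet> u v)) = m \<bullet> u a" if "a \<in> W \<or> u a = 0" for a
  proof -
    have "(\<Sum>v\<in>W. of_bool (v = a) * (m \<bullet> u v)) = (\<Sum>v\<in>W. if v = a then m \<bullet> u v else 0)"
      by (rule sum.cong) auto
    also have "\<dots> = m \<bullet> u a" using that assms(1) by (auto simp: sum.delta)
    finally show ?thesis .
  qed
  have "(\<Sum>(v, i)\<in>W \<times> UNIV. m $ i * (of_bool (v = a) - of_bool (v = b)) * (u v $ i)) =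
      (\<Sum>v\<in>W. \<Sum>i\<in>UNIV. m $ i * (of_bool (v = a) - of_bool (v = b)) * (u v $ i))"
    by (simp add: sum.cartesian_product)
  also have "\<dots> = (\<Sum>v\<in>W. of_bool (v = a) * (m \<bullet> u v) - of_bool (v = b) * (m \<bullet> u v))"
    by (rule sum.cong) (auto simp: inner_vec_def sum_negf)
  also have "\<dots> = m \<bullet> (u a - u b)"
    using single[of a] single[of b] assms by (simp add: sum_subtractf inner_diff_right)
  finally show ?thesis .
qed

lemma card_pinned_coordinates:
  assumes "finite W" "w \<in> W"
  shows "card ((W - {w}) \<times> (UNIV :: 2 set)) + 2 = 2 * card W"
  using card_Suc_Diff1[OF assms] by (simp add: card_cartesian_product)

text \<open>Pinning \<open>w\<close> at 0 removes the translations and leaves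
  \<open>2 * card V - 2\<close> unknowns, more than there are equations. A nonzero solution then
  differs somewhere from its value at \<open>w\<close>.\<close>

lemma nontrivial_solution_of_few_edges:
  fixes n :: "'e \<Rightarrow> real^2" and h t :: "'e \<Rightarrow> 'a"
  assumes "finite V" "finite E" "w \<in> V" "\<forall>e\<in>E. h e \<in> V \<and> t e \<in> V" "card E + 2 < 2 * card V"
  shows "\<exists>u. (\<forall>e\<in>E. n e \<bullet> (u (h e) - u (t e)) = 0) \<and> (\<exists>v\<in>V. u v \<noteq> u w)"
proof -
  define I where "I = (V - {w}) \<times> (UNIV :: 2 set)"
  have fin: "finite I" using assms(1) unfolding I_def by simp
  have "card E < card I" using card_pinned_coordinates[OF assms(1,3)] assms(5) unfolding I_def by linarith
  from homogeneous_system_nontrivial_solution[OF assms(2) fin this, of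
      "\<lambda>e (v, i). n e $ i * (of_bool (v = h e) - of_bool (v = t e))"]
  obtain x where x: "\<exists>i\<in>I. x i \<noteq> 0"
    "\<forall>e\<in>E. (\<Sum>i\<in>I. (case i of (v, i) \<Rightarrow> n e $ i * (of_bool (v = h e) - of_bool (v = t e))) * x i) = 0"
    by blast
  define u :: "'a \<Rightarrow> real^2" where "u = (\<lambda>v. if v \<in> V - {w} then \<chi> i. x (v, i) else 0)"
  have ux: "u v $ i = x (v, i)" if "(v, i) \<in> I" for v i using that by (simp add: I_def u_def)
  have "n e \<bullet> (u (h e) - u (t e)) = 0" if "e \<in> E" for e
  proof -
    have "n e \<bullet> (u (h e) - u (t e)) =
        (\<Sum>(v, i)\<in>I. n e $ i * (of_bool (v = h e) - of_bool (v = t e)) * (u v $ i))"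
      unfolding I_def by (rule incidence_sum[symmetric]) (use assms(1) in \<open>auto simp: u_def\<close>)
    also have "\<dots> = (\<Sum>i\<in>I. (case i of (v, i) \<Rightarrow> n e $ i * (of_bool (v = h e) - of_bool (v = t e))) * x i)"
      by (rule sum.cong) (auto simp: ux)
    finally show ?thesis using x(2) that by simp
  qed
  moreover obtain v i where "(v, i) \<in> I" "x (v, i) \<noteq> 0" using x(1) by auto
  then have "v \<in> V" "u v $ i \<noteq> 0" unfolding I_def u_def by auto
  then have "\<exists>v\<in>V. u v \<noteq> u w" unfolding u_def by (intro bexI[of _ v]) auto
  ultimately show ?thesis by blast
qed

text \<open>The transposed system: the unknowns are edge weights, with one equation for each
  coordinate of a vertex other than \<open>w\<close>. Its solutions are the self-stresses of the
  framework.\<close>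

lemma dependency_of_many_edges:
  fixes n :: "'e \<Rightarrow> real^2" and h t :: "'e \<Rightarrow> 'a"
  assumes "finite W" "finite D" "w \<in> W" "\<forall>e\<in>D. h e \<in> W \<and> t e \<in> W" "2 * card W < card D + 2"
  shows "\<exists>c. (\<exists>e\<in>D. c e \<noteq> 0) \<and> (\<forall>u. (\<Sum>e\<in>D. c e * (n e \<bullet> (u (h e) - u (t e)))) = 0)"
proof -
  define I where "I = (W - {w}) \<times> (UNIV :: 2 set)"
  have fin: "finite I" using assms(1) unfolding I_def by simp
  have "card I < card D" using card_pinned_coordinates[OF assms(1,3)] assms(5) unfolding I_def by linarith
  from homogeneous_system_nontrivial_solution[OF fin assms(2) this, of
      "\<lambda>(v, i) e. n e $ i * (of_bool (v = h e) - of_bool (v = t e))"]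
  obtain c where c: "\<exists>e\<in>D. c e \<noteq> 0"
    "\<forall>k\<in>I. (\<Sum>e\<in>D. (case k of (v, i) \<Rightarrow> \<lambda>e. n e $ i * (of_bool (v = h e) - of_bool (v = t e))) e * c e) = 0"
    by blast
  have c0: "(\<Sum>e\<in>D. n e $ i * (of_bool (v = h e) - of_bool (v = t e)) * c e) = 0" if "(v, i) \<in> I" for v i
    using bspec[OF c(2) that] by simp
  have "(\<Sum>e\<in>D. c e * (n e \<bullet> (u (h e) - u (t e)))) = 0" for u
  proof -
    \<comment> \<open>Only differences of \<open>u\<close> occur, so \<open>u\<close> may be shifted
      to vanish at \<open>w\<close>; this makes up for the omitted equations at
      \<open>w\<close>.\<close>
    define u' where "u' = (\<lambda>v. u v - u w)"
    have "(\<Sum>e\<in>D. c e * (n e \<bullet> (u (h e) - u (t e)))) =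
        (\<Sum>e\<in>D. \<Sum>(v, i)\<in>I. c e * (n e $ i * (of_bool (v = h e) - of_bool (v = t e)) * (u' v $ i)))"
    proof (rule sum.cong[OF refl])
      fix e assume "e \<in> D"
      then have "n e \<bullet> (u' (h e) - u' (t e)) =
          (\<Sum>(v, i)\<in>I. n e $ i * (of_bool (v = h e) - of_bool (v = t e)) * (u' v $ i))"
        unfolding I_def
        by (intro incidence_sum[symmetric]) (use assms(1,4) in \<open>auto simp: u'_def\<close>)
      then show "c e * (n e \<bullet> (u (h e) - u (t e))) =
          (\<Sum>(v, i)\<in>I. c e * (n e $ i * (of_bool (v = h e) - of_bool (v = t e)) * (u' v $ i)))"
        unfolding u'_def by (simp add: sum_distrib_left case_prod_unfold)
    qed
    also have "\<dots> = (\<Sum>(v, i)\<in>I. (\<Sum>e\<in>D. n e $ i * (of_bool (v = h e) - of_bool (v = t e)) * c e) * (u' v $ i))"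
      unfolding case_prod_unfold by (subst sum.swap) (simp add: sum_distrib_left sum_distrib_right mult_ac)
    also have "\<dots> = 0" by (rule sum.neutral) (auto simp: c0)
    finally show ?thesis .
  qed
  then show ?thesis using c(1) by blast
qed

section \<open>Edge equations and the necessity of the counts\<close>

context planar_unit_ball
begin

text \<open>One choice of orientation and facet normal per edge serves all edge sets
  \<open>E'\<close> at once, so that the frameworks before and after deleting an edge can be
  compared.\<close>

lemma inf_flex_iff_edge_functionals:
  assumes G: "simple_graph V E" and p: "placement E p" "well_positioned P E p"
  shows "\<exists>h t n. (\<forall>e\<in>E. {h e, t e} = e) \<and>
    (\<forall>E'\<subseteq>E. \<forall>u. inf_flex P E' p u \<longleftrightarrow> (\<forall>e\<in>E'. n e \<bullet> (u (h e) - u (t e)) = 0))"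
proof -
  have "\<exists>q. {fst q, fst (snd q)} = e \<and> facet_direction P (snd (snd q)) (p (fst q) - p (fst (snd q)))"
    if e: "e \<in> E" for e
  proof -
    have "card e = 2" using G e unfolding simple_graph_def by simp
    then obtain v w where vw: "e = {v, w}" by (auto simp: card_2_iff)
    have vwE: "{v, w} \<in> E" using e vw by simp
    then have "p v - p w \<noteq> 0" using p(1) unfolding placement_def by simp
    moreover have "\<exists>!F. F facet_of P \<and> p v - p w \<in> nonneg_combinations F"
      by (rule p(2)[unfolded well_positioned_def, rule_format, OF vwE])
    ultimately have "\<exists>F. facet_direction P F (p v - p w)" by (rule facet_direction_iff[THEN iffD1])
    then obtain F where "facet_direction P F (p v - p w)" by (rule exE)
    then show ?thesis unfolding vw by (intro exI[of _ "(v, w, F)"]) simp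
  qed
  then have "\<forall>e\<in>E. \<exists>q. {fst q, fst (snd q)} = e \<and>
      facet_direction P (snd (snd q)) (p (fst q) - p (fst (snd q)))" ..
  from bchoice[OF this] obtain q where q: "\<forall>e\<in>E. {fst (q e), fst (snd (q e))} = e \<and>
      facet_direction P (snd (snd (q e))) (p (fst (q e)) - p (fst (snd (q e))))" by (rule exE)
  define h t F where "h = (\<lambda>e. fst (q e))" "t = (\<lambda>e. fst (snd (q e)))" "F = (\<lambda>e. snd (snd (q e)))"
  note htF = this
  have ht: "{h e, t e} = e" and F: "facet_direction P (F e) (p (h e) - p (t e))" if "e \<in> E" for e
    using bspec[OF q that] unfolding htF by (rule conjunct1) (use bspec[OF q that] in \<open>rule conjunct2\<close>)
  define slow where "slow = (\<lambda>u v w. (\<lambda>s::real. poly_norm P ((p v + s *\<^sub>R u v) - (p w + s *\<^sub>R u w)) -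
      poly_norm P (p v - p w)) \<in> o[at 0](\<lambda>s. s))"
  have eq: "(p v + s *\<^sub>R u v) - (p w + s *\<^sub>R u w) = (p v - p w) + s *\<^sub>R (u v - u w)" for u v w and s :: real
    by (simp add: algebra_simps)
  \<comment> \<open>A flex is tested in both orders of the endpoints, while \<open>h\<close> and
    \<open>t\<close> fix one order; evenness of the norm makes them equivalent.\<close>
  have sym: "slow u v w \<longleftrightarrow> slow u w v" for u v w
  proof -
    have "poly_norm P ((p w + s *\<^sub>R u w) - (p v + s *\<^sub>R u v)) = poly_norm P ((p v + s *\<^sub>R u v) - (p w + s *\<^sub>R u w))"
      for s :: real by (subst poly_norm_minus[symmetric]) simp
    moreover have "poly_norm P (p w - p v) = poly_norm P (p v - p w)"
      by (subst poly_norm_minus[symmetric]) simp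
    ultimately show ?thesis unfolding slow_def by simp
  qed
  have flex: "slow u (h e) (t e) \<longleftrightarrow> nrm (F e) \<bullet> (u (h e) - u (t e)) = 0" if "e \<in> E" for e u
    unfolding slow_def eq by (rule poly_norm_smallo_iff[OF F[OF that]])
  have "inf_flex P E' p u \<longleftrightarrow> (\<forall>e\<in>E'. nrm (F e) \<bullet> (u (h e) - u (t e)) = 0)" if E': "E' \<subseteq> E" for E' u
  proof -
    have "inf_flex P E' p u \<longleftrightarrow> (\<forall>v w. {v, w} \<in> E' \<longrightarrow> slow u v w)"
      unfolding inf_flex_def slow_def ..
    also have "\<dots> \<longleftrightarrow> (\<forall>e\<in>E'. slow u (h e) (t e))"
    proof
      assume *: "\<forall>v w. {v, w} \<in> E' \<longrightarrow> slow u v w"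
      show "\<forall>e\<in>E'. slow u (h e) (t e)"
      proof
        fix e assume "e \<in> E'"
        moreover from this have "{h e, t e} = e" using E' by (intro ht) blast
        ultimately have "{h e, t e} \<in> E'" by simp
        then show "slow u (h e) (t e)" using * by blast
      qed
    next
      assume *: "\<forall>e\<in>E'. slow u (h e) (t e)"
      show "\<forall>v w. {v, w} \<in> E' \<longrightarrow> slow u v w"
      proof (intro allI impI)
        fix v w assume e: "{v, w} \<in> E'"
        define f where "f = {v, w}"
        have f: "f \<in> E'" using e unfolding f_def .
        then have "{h f, t f} = f" using E' by (intro ht) blast
        from trans[OF this f_def] have "v = h f \<and> w = t f \<or> v = t f \<and> w = h f"
          unfolding doubleton_eq_iff by auto
        then show "slow u v w" using bspec[OF * f] sym[of u v w] by auto
      qed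
    qed
    also have "\<dots> \<longleftrightarrow> (\<forall>e\<in>E'. nrm (F e) \<bullet> (u (h e) - u (t e)) = 0)"
      by (intro ball_cong refl flex) (use E' in blast)
    finally show ?thesis .
  qed
  then have "\<forall>E'\<subseteq>E. \<forall>u. inf_flex P E' p u \<longleftrightarrow> (\<forall>e\<in>E'. nrm (F e) \<bullet> (u (h e) - u (t e)) = 0)"
    by simp
  moreover have "\<forall>e\<in>E. {h e, t e} = e" using ht by simp
  ultimately show ?thesis
    by (intro exI[of _ h] exI[of _ t] exI[of _ "\<lambda>e. nrm (F e)"] conjI)
qed

lemma inf_rigid_card_edges:
  assumes fin: "finite V" and G: "simple_graph V E"
    and p: "placement E p" "well_positioned P E p" and rigid: "inf_rigid P V E p"
  shows "2 * card V \<le> card E + 2"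
proof (rule ccontr)
  obtain h t n where ht: "\<forall>e\<in>E. {h e, t e} = e"
    and flex: "\<forall>E'\<subseteq>E. \<forall>u. inf_flex P E' p u \<longleftrightarrow> (\<forall>e\<in>E'. n e \<bullet> (u (h e) - u (t e)) = 0)"
    using inf_flex_iff_edge_functionals[OF G p] by (elim exE conjE) (rule that)
  obtain w where w: "w \<in> V" using G unfolding simple_graph_def by blast
  have inV: "\<forall>e\<in>E. h e \<in> V \<and> t e \<in> V"
  proof
    fix e assume e: "e \<in> E"
    have "e \<subseteq> V" using G e unfolding simple_graph_def by blast
    then have "{h e, t e} \<subseteq> V" using bspec[OF ht e] by simp
    then show "h e \<in> V \<and> t e \<in> V" by simp
  qed
  assume "\<not> ?thesis"
  then have "card E + 2 < 2 * card V" by simp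
  from nontrivial_solution_of_few_edges[where n = n and h = h and t = t, OF fin finite_edges[OF fin G] w inV this]
  obtain u v where u: "\<forall>e\<in>E. n e \<bullet> (u (h e) - u (t e)) = 0" "v \<in> V" "u v \<noteq> u w"
    by (elim exE conjE bexE) (rule that)
  have "inf_flex P E p u"
    by (rule flex[THEN spec, THEN mp, OF subset_refl, THEN spec, THEN iffD2, OF u(1)])
  then have "trivial_flex V u" using rigid unfolding inf_rigid_def by simp
  then obtain c where "\<forall>v\<in>V. u v = c" unfolding trivial_flex_def by (rule exE)
  then show False using u(2,3) w by simp
qed

text \<open>Deleting \<open>e\<close> must create a new flex, which satisfies every edge equation
  except that of \<open>e\<close>. Such witnesses rule out linear dependencies among the edge
  equations, whereas a subgraph with too many edges would have one.\<close>

lemma min_inf_rigid_imp_tight22: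
  assumes fin: "finite V" and G: "simple_graph V E"
    and p: "placement E p" "well_positioned P E p" and rigid: "min_inf_rigid P V E p"
  shows "tight22 V E"
proof -
  obtain h t n where ht: "\<forall>e\<in>E. {h e, t e} = e"
    and flex: "\<forall>E'\<subseteq>E. \<forall>u. inf_flex P E' p u \<longleftrightarrow> (\<forall>e\<in>E'. n e \<bullet> (u (h e) - u (t e)) = 0)"
    using inf_flex_iff_edge_functionals[OF G p] by (elim exE conjE) (rule that)
  have "\<exists>u. (\<forall>f\<in>E - {e}. n f \<bullet> (u (h f) - u (t f)) = 0) \<and> n e \<bullet> (u (h e) - u (t e)) \<noteq> 0"
    if e: "e \<in> E" for e
  proof -
    obtain u where u: "inf_flex P (E - {e}) p u" "\<not> trivial_flex V u"
      using rigid e unfolding min_inf_rigid_def inf_rigid_def by blast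
    have "\<forall>f\<in>E - {e}. n f \<bullet> (u (h f) - u (t f)) = 0"
      by (rule flex[THEN spec, THEN mp, OF Diff_subset, THEN spec, THEN iffD1, OF u(1)])
    moreover have "\<not> inf_flex P E p u" using u(2) rigid unfolding min_inf_rigid_def inf_rigid_def by blast
    then have "\<not> (\<forall>f\<in>E. n f \<bullet> (u (h f) - u (t f)) = 0)"
      using flex[THEN spec, THEN mp, OF subset_refl, THEN spec, of u] by simp
    ultimately show ?thesis by (intro exI[of _ u]) blast
  qed
  then have "\<forall>e\<in>E. \<exists>u. (\<forall>f\<in>E - {e}. n f \<bullet> (u (h f) - u (t f)) = 0) \<and> n e \<bullet> (u (h e) - u (t e)) \<noteq> 0" ..
  from bchoice[OF this] obtain U where
    "\<forall>e\<in>E. (\<forall>f\<in>E - {e}. n f \<bullet> (U e (h f) - U e (t f)) = 0) \<and> n e \<bullet> (U e (h e) - U e (t e)) \<noteq> 0"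
    by (rule exE)
  then have U: "\<And>e f. e \<in> E \<Longrightarrow> f \<in> E - {e} \<Longrightarrow> n f \<bullet> (U e (h f) - U e (t f)) = 0"
    "\<And>e. e \<in> E \<Longrightarrow> n e \<bullet> (U e (h e) - U e (t e)) \<noteq> 0" by blast+
  have sparse: "card D + 2 \<le> 2 * card W" if WD: "subgraph_of W D V E" for W D
  proof (rule ccontr)
    assume "\<not> ?thesis"
    then have gt: "2 * card W < card D + 2" by simp
    have W: "simple_graph W D" "W \<subseteq> V" "D \<subseteq> E" using WD unfolding subgraph_of_def by auto
    have finW: "finite W" using W fin finite_subset by blast
    have finD: "finite D" by (rule finite_edges[OF finW W(1)])
    obtain w where w: "w \<in> W" using W(1) unfolding simple_graph_def by blast
    have inW: "\<forall>e\<in>D. h e \<in> W \<and> t e \<in> W"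
    proof
      fix e assume e: "e \<in> D"
      have "e \<subseteq> W" "e \<in> E" using W(1,3) e unfolding simple_graph_def by blast+
      then have "{h e, t e} \<subseteq> W" using bspec[OF ht, of e] by simp
      then show "h e \<in> W \<and> t e \<in> W" by simp
    qed
    from dependency_of_many_edges[where n = n and h = h and t = t, OF finW finD w inW gt]
    obtain c e where c: "e \<in> D" "c e \<noteq> 0"
      "\<And>u. (\<Sum>f\<in>D. c f * (n f \<bullet> (u (h f) - u (t f)))) = 0" by blast
    have e: "e \<in> E" using c W by blast
    \<comment> \<open>Evaluated at the witness \<open>U e\<close>, the dependency collapses to its
      term at \<open>e\<close>, whose two factors are nonzero.\<close>
    have "0 = (\<Sum>f\<in>D. c f * (n f \<bullet> (U e (h f) - U e (t f))))" using c(3) by simp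
    also have "\<dots> = c e * (n e \<bullet> (U e (h e) - U e (t e)))"
    proof -
      have "(\<Sum>f\<in>D - {e}. c f * (n f \<bullet> (U e (h f) - U e (t f)))) = 0"
        by (rule sum.neutral) (use U(1)[OF e] W(3) in auto)
      then show ?thesis by (subst sum.remove[OF finD c(1)]) simp
    qed
    finally show False using c(2) U(2)[OF e] by simp
  qed
  have "subgraph_of V E V E" using G unfolding subgraph_of_def by simp
  from sparse[OF this] have "card E + 2 \<le> 2 * card V" .
  moreover have "2 * card V \<le> card E + 2"
    using inf_rigid_card_edges[OF fin G p] rigid unfolding min_inf_rigid_def by blast
  ultimately have "card E + 2 = 2 * card V" by simp
  then have "int (card E) = 2 * int (card V) - 2" by linarith
  moreover have "int (card D) \<le> 2 * int (card W) - 2" if "subgraph_of W D V E" for W D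
    using sparse[OF that] by linarith
  ultimately show ?thesis unfolding tight22_def by blast
qed

section \<open>From drawings to rigid placements\<close>

lemma biconnected_drawing_rigid_placement:
  assumes fin: "finite V" and G: "simple_graph V E" and draw: "biconnected_drawing V E x y"
  shows "\<exists>p. placement E p \<and> well_positioned P E p \<and> inf_rigid P V E p"
proof -
  obtain F1 F2 x0 y0 where F12: "F1 facet_of P" "F2 facet_of P" "nrm F1 \<bullet> x0 = 1" "nrm F2 \<bullet> x0 = 1"
    and le: "\<forall>F. F facet_of P \<longrightarrow> nrm F \<bullet> x0 \<le> 1"
    and F1: "\<forall>F. F facet_of P \<and> F \<noteq> F1 \<and> nrm F \<bullet> x0 = 1 \<longrightarrow> nrm F \<bullet> y0 < nrm F1 \<bullet> y0"
    and F2: "\<forall>F. F facet_of P \<and> F \<noteq> F2 \<and> nrm F \<bullet> x0 = 1 \<longrightarrow> nrm F2 \<bullet> y0 < nrm F \<bullet> y0"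
    and indep: "\<forall>u. nrm F1 \<bullet> u = 0 \<and> nrm F2 \<bullet> u = 0 \<longrightarrow> u = 0"
    by (rule two_facets_at_extreme_point)
  \<comment> \<open>With an edge read in the direction of increasing \<open>x\<close>, a positive
    difference in \<open>y\<close> means sign 1 and selects \<open>F1\<close>, a negative one means
    sign -1 and selects \<open>F2\<close>.\<close>
  define fct where "fct = (\<lambda>b::real. if 0 < b then F1 else F2)"
  have tilt: "\<forall>\<^sub>F s in at_right 0. facet_direction P (fct b) (a *\<^sub>R x0 + (s * b) *\<^sub>R y0)"
    if ab: "0 < a" "b \<noteq> 0" for a b :: real
  proof (rule eventually_facet_direction)
    show "((\<lambda>s. a *\<^sub>R x0 + (s * b) *\<^sub>R y0) \<longlongrightarrow> a *\<^sub>R x0) (at_right 0)"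
      by (auto intro!: tendsto_eq_intros)
    show "fct b facet_of P" "0 < nrm (fct b) \<bullet> (a *\<^sub>R x0)" using F12 ab by (auto simp: fct_def)
    fix F assume F: "F facet_of P" "F \<noteq> fct b"
    have one: "nrm (fct b) \<bullet> x0 = 1" using F12 by (auto simp: fct_def)
    show "nrm F \<bullet> (a *\<^sub>R x0) < nrm (fct b) \<bullet> (a *\<^sub>R x0) \<or>
      (\<forall>\<^sub>F s in at_right 0. nrm F \<bullet> (a *\<^sub>R x0 + (s * b) *\<^sub>R y0) < nrm (fct b) \<bullet> (a *\<^sub>R x0 + (s * b) *\<^sub>R y0))"
    proof (cases "nrm F \<bullet> x0 = 1")
      case True
      \<comment> \<open>Among the facets through \<open>x0\<close> the tilt decides:
        \<open>F1\<close> has the largest and \<open>F2\<close> the smallest product with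
        \<open>y0\<close>, and the sign of \<open>b\<close> says which of them wins.\<close>
      have "b * (nrm F \<bullet> y0) < b * (nrm (fct b) \<bullet> y0)"
        using F ab True F1[rule_format, of F] F2[rule_format, of F] by (auto simp: fct_def split: if_splits)
      then have lt: "s * (b * (nrm F \<bullet> y0)) < s * (b * (nrm (fct b) \<bullet> y0))" if "0 < s" for s
        using that by (rule mult_strict_left_mono)
      have "\<forall>\<^sub>F s in at_right 0. 0 < (s::real)" by (simp add: eventually_at_filter)
      then have "\<forall>\<^sub>F s in at_right 0. nrm F \<bullet> (a *\<^sub>R x0 + (s * b) *\<^sub>R y0) < nrm (fct b) \<bullet> (a *\<^sub>R x0 + (s * b) *\<^sub>R y0)"
      proof eventually_elim
        case (elim s)
        from lt[OF this] show ?case by (simp add: inner_add_right True one mult.assoc)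
      qed
      then show ?thesis ..
    next
      case False
      then have "nrm F \<bullet> x0 < 1" using le F(1) by fastforce
      then show ?thesis using ab one by simp
    qed
  qed
  have inj: "x v \<noteq> x w" "y v \<noteq> y w" if "v \<in> V" "w \<in> V" "v \<noteq> w" for v w
    using draw that unfolding biconnected_drawing_def inj_on_def by auto
  have "\<forall>\<^sub>F s in at_right 0. \<forall>q\<in>V \<times> V. x (snd q) < x (fst q) \<longrightarrow>
      facet_direction P (fct (y (fst q) - y (snd q)))
        ((x (fst q) - x (snd q)) *\<^sub>R x0 + (s * (y (fst q) - y (snd q))) *\<^sub>R y0)"
  proof (rule eventually_ball_finite, goal_cases)
    case 2
    show ?case
    proof
      fix q assume q: "q \<in> V \<times> V"
      show "\<forall>\<^sub>F s in at_right 0. x (snd q) < x (fst q) \<longrightarrow>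
        facet_direction P (fct (y (fst q) - y (snd q)))
        ((x (fst q) - x (snd q)) *\<^sub>R x0 + (s * (y (fst q) - y (snd q))) *\<^sub>R y0)"
      proof (cases "x (snd q) < x (fst q)")
        case True
        then have "fst q \<noteq> snd q" by auto
        then have "y (fst q) - y (snd q) \<noteq> 0" using inj q by (auto simp: mem_Times_iff)
        from tilt[OF _ this, of "x (fst q) - x (snd q)"] True show ?thesis by simp
      qed simp
    qed
  qed (use fin in simp)
  from eventually_happens'[OF trivial_limit_at_right_real this]
  obtain s where s: "\<forall>q\<in>V \<times> V. x (snd q) < x (fst q) \<longrightarrow>
      facet_direction P (fct (y (fst q) - y (snd q)))
        ((x (fst q) - x (snd q)) *\<^sub>R x0 + (s * (y (fst q) - y (snd q))) *\<^sub>R y0)" by (rule exE)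
  define p where "p = (\<lambda>v. x v *\<^sub>R x0 + (s * y v) *\<^sub>R y0)"
  have diff: "p v - p w = (x v - x w) *\<^sub>R x0 + (s * (y v - y w)) *\<^sub>R y0" for v w
    unfolding p_def by (simp add: algebra_simps)
  have dir: "facet_direction P (fct (y v - y w)) (p v - p w)" if "v \<in> V" "w \<in> V" "x w < x v" for v w
    using bspec[OF s, of "(v, w)"] that unfolding diff by simp
  have edge: "v \<in> V" "w \<in> V" "v \<noteq> w" if "{v, w} \<in> E" for v w
  proof -
    have "{v, w} \<subseteq> V" "card {v, w} = 2" using G that unfolding simple_graph_def by blast+
    then show "v \<in> V" "w \<in> V" "v \<noteq> w" by (auto simp: card_2_iff')
  qed
  have ne: "p v \<noteq> p w" if "{v, w} \<in> E" for v w
  proof -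
    have "x v < x w \<or> x w < x v" using inj(1) edge[OF that] by (meson linorder_neqE_linordered_idom)
    then have "p v - p w \<noteq> 0 \<or> p w - p v \<noteq> 0"
      using dir edge[OF that] facet_direction_poly_norm(1) by blast
    then show ?thesis by auto
  qed
  have well: "\<exists>!F. F facet_of P \<and> p v - p w \<in> nonneg_combinations F" if "{v, w} \<in> E" for v w
  proof -
    have pos: "\<exists>!F. F facet_of P \<and> p v - p w \<in> nonneg_combinations F"
      if "v \<in> V" "w \<in> V" "x w < x v" for v w
      using facet_direction_iff[OF facet_direction_poly_norm(1)[OF dir[OF that]]] dir[OF that] by blast
    have "x v < x w \<or> x w < x v" using inj(1) edge[OF that] by (meson linorder_neqE_linordered_idom)
    then show ?thesis
    proof
      assume "x v < x w"
      from unique_facet_uminus[OF pos[OF edge(2,1)[OF that] this]] show ?thesis by simp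
    next
      assume "x w < x v"
      from pos[OF edge(1,2)[OF that] this] show ?thesis .
    qed
  qed
  have "trivial_flex V u" if flex: "inf_flex P E p u" for u
  proof -
    have slow: "(\<lambda>r::real. poly_norm P ((p v - p w) + r *\<^sub>R (u v - u w)) - poly_norm P (p v - p w)) \<in> o[at 0](\<lambda>r. r)"
      if "{v, w} \<in> E" for v w
    proof -
      have "(p v + r *\<^sub>R u v) - (p w + r *\<^sub>R u w) = (p v - p w) + r *\<^sub>R (u v - u w)" for r :: real
        by (simp add: scaleR_diff_right)
      moreover have "(\<lambda>r::real. poly_norm P ((p v + r *\<^sub>R u v) - (p w + r *\<^sub>R u w)) - poly_norm P (p v - p w)) \<in> o[at 0](\<lambda>r. r)"
        using flex that unfolding inf_flex_def by blast
      ultimately show ?thesis by presburger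
    qed
    \<comment> \<open>On edges of sign \<open>c\<close> the flex condition says that the component
      of \<open>u\<close> along the normal of \<open>fct c\<close> does not change. Connectedness of
      this sign class then makes the component constant on \<open>V\<close>.\<close>
    have const: "nrm (fct c) \<bullet> u v = nrm (fct c) \<bullet> u w" if c: "c \<in> {1, -1}" and vw: "v \<in> V" "w \<in> V" for c v w
    proof -
      have upward: "nrm (fct c) \<bullet> u v = nrm (fct c) \<bullet> u w"
        if "{v, w} \<in> E" "0 < c * ((x v - x w) * (y v - y w))" "x w < x v" for v w
      proof -
        have "0 < (c * (y v - y w)) * (x v - x w)" using that(2) by (simp add: mult_ac)
        then have "0 < c * (y v - y w)" by (rule zero_less_mult_pos2) (use that(3) in simp)
        then have "fct (y v - y w) = fct c" using c by (auto simp: fct_def)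
        then have "nrm (fct c) \<bullet> (u v - u w) = 0"
          using poly_norm_smallo_iff[OF dir[OF edge(1,2)[OF that(1)] that(3)], THEN iffD1, OF slow[OF that(1)]]
          by (rule subst)
        then show ?thesis by (simp add: inner_diff_right)
      qed
      have "nrm (fct c) \<bullet> u v = nrm (fct c) \<bullet> u w"
        if e: "{v, w} \<in> E" "0 < c * ((x v - x w) * (y v - y w))" for v w
      proof -
        have "x v < x w \<or> x w < x v" using inj(1) edge[OF e(1)] by (meson linorder_neqE_linordered_idom)
        then show ?thesis
        proof
          assume "x v < x w"
          moreover have "{w, v} \<in> E" using e(1) by (simp add: insert_commute)
          moreover have "(x w - x v) * (y w - y v) = (x v - x w) * (y v - y w)" by (simp add: algebra_simps)
          ultimately show ?thesis using upward[of w v] e(2) by simp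
        qed (rule upward[OF e])
      qed
      moreover have "sign_connected c V E x y" using draw c unfolding biconnected_drawing_def by blast
      ultimately have "\<forall>v\<in>V. \<forall>w\<in>V. nrm (fct c) \<bullet> u v = nrm (fct c) \<bullet> u w"
        unfolding sign_connected_def by meson
      then show ?thesis using vw by blast
    qed
    have "u v = u w" if "v \<in> V" "w \<in> V" for v w
    proof -
      have "nrm F1 \<bullet> (u v - u w) = 0" "nrm F2 \<bullet> (u v - u w) = 0"
        using const[of 1, OF _ that] const[of "-1", OF _ that] by (simp_all add: fct_def inner_diff_right)
      then have "u v - u w = 0" using indep by blast
      then show ?thesis by simp
    qed
    moreover obtain w where "w \<in> V" using G unfolding simple_graph_def by blast
    ultimately show ?thesis unfolding trivial_flex_def by (intro exI[of _ "u w"]) blast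
  qed
  then have "inf_rigid P V E p" unfolding inf_rigid_def by blast
  moreover have "placement E p" "well_positioned P E p"
    using ne well unfolding placement_def well_positioned_def by blast+
  ultimately show ?thesis by blast
qed

text \<open>Minimality comes from counting: a tight graph has exactly the least number of edges that
  infinitesimal rigidity permits, so no edge of a rigid placement can be spared.\<close>

lemma tight22_imp_minimally_rigid:
  assumes fin: "finite V" and G: "simple_graph V E" and tight: "tight22 V E"
  shows "minimally_rigid P V E"
proof -
  have T: "tight_graph V E" by (rule tight22_imp_tight_graph[OF fin G tight])
  then obtain x y where "biconnected_drawing V E x y" using tight_graph_biconnected_drawing by blast
  from biconnected_drawing_rigid_placement[OF fin G this]
  obtain p where p: "placement E p" "well_positioned P E p" "inf_rigid P V E p" by blast
  have "\<not> inf_rigid P V (E - {e}) p" if e: "e \<in> E" for e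
  proof
    assume rigid: "inf_rigid P V (E - {e}) p"
    have "simple_graph V (E - {e})" using G unfolding simple_graph_def by blast
    moreover have "placement (E - {e}) p" using p(1) unfolding placement_def by blast
    moreover have "well_positioned P (E - {e}) p" using p(2) unfolding well_positioned_def by simp
    ultimately have "2 * card V \<le> card (E - {e}) + 2"
      using inf_rigid_card_edges[OF fin _ _ _ rigid] by blast
    moreover have "Suc (card (E - {e})) = card E" by (rule card_Suc_Diff1[OF finite_edges[OF fin G] e])
    ultimately show False using T unfolding tight_graph_def by linarith
  qed
  then show ?thesis using p unfolding minimally_rigid_def min_inf_rigid_def by blast
qed

end

theorem theorem4p9:
  fixes P :: "(real^2) set" and V :: "'a set" and E :: "'a set set"
  assumes "symmetric_polytope2 P"
    and "finite V" and "simple_graph V E"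
  shows "minimally_rigid P V E \<longleftrightarrow> tight22 V E"
proof -
  interpret planar_unit_ball P by unfold_locales (rule assms(1))
  show ?thesis
  proof
    assume "minimally_rigid P V E"
    then obtain p where p: "placement E p" "well_positioned P E p" "min_inf_rigid P V E p"
      unfolding minimally_rigid_def by blast
    show "tight22 V E" by (rule min_inf_rigid_imp_tight22[OF assms(2,3) p])
  qed (rule tight22_imp_minimally_rigid[OF assms(2,3)])
qed

end
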